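(* Let $T\colon X\to E$ be an operator from a Banach space $X$ into a Banach lattice $E$. (1) If $E'$ is order continuous and $T$ is $uaw$-compact or sequentially $uaw$-compact, then $T$ is weakly compact. (2) If the lattice operations of $E$ are sequentially weakly continuous and $T$ is weakly compact, then $T$ is sequentially $uaw$-compact. (3) If the lattice operations of $E$ are sequentially weakly continuous and $E'$ is order continuous, then $T$ is weakly compact if and only if it is sequentially $uaw$-compact. (4) If $E$ is discrete and both $E$ and $E'$ are order continuous, then the following are equivalent: $T$ is weakly compact; $T$ is $uaw$-compact; $T$ is sequentially $uaw$-compact; $T$ is $un$-compact; $T$ is sequentially $un$-compact.
   Context: Operator means bounded linear operator. $E^+$ denotes the positive cone of $E$ and $E'$ its norm dual, which is a Banach lattice. A Banach lattice is called order continuous if its norm is order continuous. A Banach lattice $E$ is discrete (atomic) if every nonzero positive element dominates an atom, where an atom is an element $a>0$ such that the order ideal generated by $a$ equals the linear span of $a$. The lattice operations of $E$ are sequentially weakly continuous if for every sequence $(x_n)\subset E$, $x_n\to0$ weakly implies $|x_n|\to0$ weakly. A net (or sequence) $(x_\alpha)$ in $E$ is $un$-convergent to $x\in E$ if $\big\||x_\alpha-x|\wedge u\big\|\to0$ for every $u\in E^+$; it is $uaw$-convergent to $x$ if $|x_\alpha-x|\wedge u\to0$ weakly for every $u\in E^+$. An operator $T\colon X\to E$ is $un$-compact (resp. $uaw$-compact) if for every norm bounded net $(x_\alpha)$ in $X$ the net $(Tx_\alpha)$ has a subnet which is $un$-convergent (resp. $uaw$-convergent) in $E$; it is sequentially $un$-compact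 (resp. sequentially $uaw$-compact) if for every norm bounded sequence $(x_n)$ in $X$ the sequence $(Tx_n)$ has a subsequence which is $un$-convergent (resp. $uaw$-convergent) in $E$. *)

theory Defs
  imports "HOL-Analysis.Analysis" "HOL-Library.Lattice_Algebras"
begin

section \<open>Banach lattices\<close>

class banach_lattice = lattice_ab_group_add_abs + ordered_real_vector + banach +
  assumes norm_le_norm_if_abs_le: "\<bar>x\<bar> \<le> \<bar>y\<bar> \<Longrightarrow> norm x \<le> norm y"

instance real :: banach_lattice
  by standard (auto simp: sup_real_def)

text \<open>The norm dual of \<open>'a\<close> is \<open>'a \<Rightarrow>\<^sub>L real\<close>, ordered by \<open>f \<le> g\<close> iff \<open>f x \<le> g x\<close>
  for all \<open>x \<ge> 0\<close>.\<close>

instantiation blinfun :: (banach_lattice, "{real_normed_vector, order}") order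
begin

definition less_eq_blinfun :: "('a \<Rightarrow>\<^sub>L 'b) \<Rightarrow> ('a \<Rightarrow>\<^sub>L 'b) \<Rightarrow> bool"
  where "less_eq_blinfun f g \<longleftrightarrow> (\<forall>x\<ge>0. blinfun_apply f x \<le> blinfun_apply g x)"

definition less_blinfun :: "('a \<Rightarrow>\<^sub>L 'b) \<Rightarrow> ('a \<Rightarrow>\<^sub>L 'b) \<Rightarrow> bool"
  where "less_blinfun f g \<longleftrightarrow> f \<le> g \<and> \<not> g \<le> f"

instance
proof
  fix f g h :: "'a \<Rightarrow>\<^sub>L 'b"
  show "f < g \<longleftrightarrow> f \<le> g \<and> \<not> g \<le> f"
    by (simp add: less_blinfun_def)
  show "f \<le> f"
    by (simp add: less_eq_blinfun_def)
  show "f \<le> h" if "f \<le> g" "g \<le> h"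
    using that by (auto simp: less_eq_blinfun_def intro: order_trans)
  show "f = g" if "f \<le> g" "g \<le> f"
  proof (rule blinfun_eqI)
    fix x :: 'a
    have eq: "blinfun_apply f y = blinfun_apply g y" if "0 \<le> y" for y
      using that \<open>f \<le> g\<close> \<open>g \<le> f\<close> by (auto simp: less_eq_blinfun_def intro: antisym)
    have x: "x = pprt x - (- nprt x)"
      using prts[of x] by simp
    have "0 \<le> pprt x" "0 \<le> - nprt x"
      by simp_all
    then have "blinfun_apply f (pprt x - (- nprt x)) = blinfun_apply g (pprt x - (- nprt x))"
      unfolding blinfun.diff_right by (simp only: eq)
    then show "blinfun_apply f x = blinfun_apply g x"
      using x by metis
  qed
qed

end


section \<open>Nets\<close>

definition directed :: "'i set \<Rightarrow> ('i \<Rightarrow> 'i \<Rightarrow> bool) \<Rightarrow> bool" where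
  "directed I le \<longleftrightarrow> I \<noteq> {} \<and> (\<forall>i\<in>I. le i i) \<and>
     (\<forall>i\<in>I. \<forall>j\<in>I. \<forall>k\<in>I. le i j \<longrightarrow> le j k \<longrightarrow> le i k) \<and>
     (\<forall>i\<in>I. \<forall>j\<in>I. \<exists>k\<in>I. le i k \<and> le j k)"

text \<open>The filter of tails, so that convergence of the net \<open>(x\<^sub>i)\<close>, \<open>i \<in> I\<close>, is convergence of
  \<open>x\<close> along \<open>net_filter I le\<close>.\<close>

definition net_filter :: "'i set \<Rightarrow> ('i \<Rightarrow> 'i \<Rightarrow> bool) \<Rightarrow> 'i filter" where
  "net_filter I le = (INF i\<in>I. principal {j\<in>I. le i j})"

lemma eventually_net_filter:
  assumes "directed I le"
  shows "eventually P (net_filter I le) \<longleftrightarrow> (\<exists>i\<in>I. \<forall>j\<in>I. le i j \<longrightarrow> P j)"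
proof -
  have "\<exists>k\<in>I. principal {j\<in>I. le k j} \<le> inf (principal {l\<in>I. le i l}) (principal {l\<in>I. le j l})"
    if ij: "i \<in> I" "j \<in> I" for i j
  proof -
    obtain k where k: "k \<in> I" "le i k" "le j k"
      using assms ij unfolding directed_def by blast
    have tr: "le i l" if "i \<in> I" "k \<in> I" "l \<in> I" "le i k" "le k l" for i k l
      using assms that unfolding directed_def by blast
    have "{l\<in>I. le k l} \<subseteq> {l\<in>I. le i l} \<inter> {l\<in>I. le j l}"
      using tr[OF ij(1) k(1) _ k(2)] tr[OF ij(2) k(1) _ k(3)] by auto
    then have "principal {j\<in>I. le k j} \<le> inf (principal {l\<in>I. le i l}) (principal {l\<in>I. le j l})"
      by (simp only: inf_principal principal_le_iff)
    then show ?thesis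
      using k(1) by blast
  qed
  moreover have "I \<noteq> {}"
    using assms unfolding directed_def by blast
  ultimately have "eventually P (net_filter I le) \<longleftrightarrow>
      (\<exists>i\<in>I. eventually P (principal {j\<in>I. le i j}))"
    unfolding net_filter_def by (intro eventually_INF_base) simp_all
  then show ?thesis
    by (simp add: eventually_principal Ball_def imp_conjL)
qed

text \<open>Subnets in the sense of Kelley: \<open>(x\<^sub>h\<^sub>(\<^sub>j\<^sub>))\<close>, \<open>j \<in> J\<close>, is a subnet of \<open>(x\<^sub>i)\<close>, \<open>i \<in> I\<close>.\<close>

definition subnet_map ::
  "'j set \<Rightarrow> ('j \<Rightarrow> 'j \<Rightarrow> bool) \<Rightarrow> 'i set \<Rightarrow> ('i \<Rightarrow> 'i \<Rightarrow> bool) \<Rightarrow> ('j \<Rightarrow> 'i) \<Rightarrow> bool" where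
  "subnet_map J le' I le h \<longleftrightarrow> h ` J \<subseteq> I \<and>
     (\<forall>i\<in>I. \<exists>j0\<in>J. \<forall>j\<in>J. le' j0 j \<longrightarrow> le i (h j))"


section \<open>Properties of Banach lattices\<close>

text \<open>\<open>x\<^sub>\<alpha> \<down> 0\<close> implies \<open>\<parallel>x\<^sub>\<alpha>\<parallel> \<rightarrow> 0\<close>. A decreasing net may be indexed by its own range;
  see \<open>order_continuous_norm_net\<close> below for arbitrary index sets.\<close>

definition order_continuous_norm :: "'a :: {real_normed_vector, order} itself \<Rightarrow> bool" where
  "order_continuous_norm _ \<longleftrightarrow>
     (\<forall>D :: 'a set. directed D (\<lambda>a b. b \<le> a) \<and>
        (\<forall>a\<in>D. 0 \<le> a) \<and> (\<forall>l. (\<forall>a\<in>D. l \<le> a) \<longrightarrow> l \<le> 0) \<longrightarrow>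
        (norm \<longlongrightarrow> 0) (net_filter D (\<lambda>a b. b \<le> a)))"

lemma order_continuous_norm_net:
  fixes x :: "'i \<Rightarrow> 'a :: {real_normed_vector, order}"
  assumes oc: "order_continuous_norm TYPE('a)"
    and dir: "directed I le"
    and dec: "\<And>i j. i \<in> I \<Longrightarrow> j \<in> I \<Longrightarrow> le i j \<Longrightarrow> x j \<le> x i"
    and lb: "\<And>i. i \<in> I \<Longrightarrow> 0 \<le> x i"
    and glb: "\<And>l. (\<And>i. i \<in> I \<Longrightarrow> l \<le> x i) \<Longrightarrow> l \<le> 0"
  shows "((\<lambda>i. norm (x i)) \<longlongrightarrow> 0) (net_filter I le)"
proof -
  let ?ge = "\<lambda>a b :: 'a. b \<le> a"
  have d: "directed (x ` I) ?ge"
    unfolding directed_def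
  proof (intro conjI ballI impI)
    show "x ` I \<noteq> {}"
      using dir unfolding directed_def by blast
  next
    fix a b assume "a \<in> x ` I" "b \<in> x ` I"
    then obtain i j where ij: "i \<in> I" "j \<in> I" "a = x i" "b = x j"
      by blast
    then obtain k where "k \<in> I" "le i k" "le j k"
      using dir unfolding directed_def by blast
    then show "\<exists>c\<in>x ` I. c \<le> a \<and> c \<le> b"
      using dec ij by blast
  qed auto
  have "\<forall>l. (\<forall>a\<in>x ` I. l \<le> a) \<longrightarrow> l \<le> 0"
    using glb by blast
  then have lim: "(norm \<longlongrightarrow> 0) (net_filter (x ` I) ?ge)"
    using oc d lb unfolding order_continuous_norm_def by blast
  show ?thesis
    unfolding tendsto_iff eventually_net_filter[OF dir]
  proof (intro allI impI)
    fix e :: real assume "0 < e"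
    then obtain i where i: "i \<in> I" "\<forall>b\<in>x ` I. b \<le> x i \<longrightarrow> dist (norm b) 0 < e"
      using lim unfolding tendsto_iff eventually_net_filter[OF d] by blast
    then show "\<exists>i\<in>I. \<forall>j\<in>I. le i j \<longrightarrow> dist (norm (x j)) 0 < e"
      using dec by blast
  qed
qed

definition order_ideal :: "'a :: banach_lattice set \<Rightarrow> bool" where
  "order_ideal I \<longleftrightarrow> subspace I \<and> (\<forall>x y. y \<in> I \<longrightarrow> \<bar>x\<bar> \<le> \<bar>y\<bar> \<longrightarrow> x \<in> I)"

definition atom :: "'a :: banach_lattice \<Rightarrow> bool" where
  "atom a \<longleftrightarrow> 0 < a \<and> order_ideal hull {a} = span {a}"

definition discrete_lattice :: "'a :: banach_lattice itself \<Rightarrow> bool" where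
  "discrete_lattice _ \<longleftrightarrow> (\<forall>x :: 'a. 0 < x \<longrightarrow> (\<exists>a. atom a \<and> a \<le> x))"

definition weak_topology :: "'a :: real_normed_vector topology" where
  "weak_topology = pullback_topology UNIV (\<lambda>x (\<phi> :: 'a \<Rightarrow>\<^sub>L real). blinfun_apply \<phi> x) euclidean"

definition lattice_ops_seq_weakly_continuous :: "'a :: banach_lattice itself \<Rightarrow> bool" where
  "lattice_ops_seq_weakly_continuous _ \<longleftrightarrow>
     (\<forall>x :: nat \<Rightarrow> 'a. limitin weak_topology x 0 sequentially \<longrightarrow>
        limitin weak_topology (\<lambda>n. \<bar>x n\<bar>) 0 sequentially)"

lemma topspace_weak_topology [simp]: "topspace weak_topology = UNIV"
  by (simp add: weak_topology_def topspace_pullback_topology)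

lemma limitin_weak_topology_iff:
  fixes f :: "'i \<Rightarrow> 'a :: real_normed_vector"
  shows "limitin weak_topology f x F \<longleftrightarrow>
    (\<forall>\<phi> :: 'a \<Rightarrow>\<^sub>L real. ((\<lambda>i. blinfun_apply \<phi> (f i)) \<longlongrightarrow> blinfun_apply \<phi> x) F)"
proof -
  define ev where "ev = (\<lambda>x (\<phi> :: 'a \<Rightarrow>\<^sub>L real). blinfun_apply \<phi> x)"
  have "limitin weak_topology f x F \<longleftrightarrow> ((\<lambda>i. ev (f i)) \<longlongrightarrow> ev x) F"
    unfolding limitin_def topspace_weak_topology
    by (auto simp: weak_topology_def ev_def openin_pullback_topology tendsto_def)
  also have "\<dots> \<longleftrightarrow> (\<forall>\<phi>. ((\<lambda>i. ev (f i) \<phi>) \<longlongrightarrow> ev x \<phi>) F)"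
    unfolding limitin_canonical_iff[symmetric] euclidean_product_topology[symmetric]
    by (simp add: limitin_componentwise)
  finally show ?thesis
    by (simp add: ev_def)
qed


section \<open>Unbounded convergence and classes of operators\<close>

definition un_tendsto :: "('i \<Rightarrow> 'e :: banach_lattice) \<Rightarrow> 'e \<Rightarrow> 'i filter \<Rightarrow> bool" where
  "un_tendsto f y F \<longleftrightarrow> (\<forall>u\<ge>0. ((\<lambda>i. norm (inf \<bar>f i - y\<bar> u)) \<longlongrightarrow> 0) F)"

definition uaw_tendsto :: "('i \<Rightarrow> 'e :: banach_lattice) \<Rightarrow> 'e \<Rightarrow> 'i filter \<Rightarrow> bool" where
  "uaw_tendsto f y F \<longleftrightarrow> (\<forall>u\<ge>0. limitin weak_topology (\<lambda>i. inf \<bar>f i - y\<bar> u) 0 F)"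

definition weakly_compact_op :: "('x :: real_normed_vector \<Rightarrow>\<^sub>L 'e :: real_normed_vector) \<Rightarrow> bool" where
  "weakly_compact_op T \<longleftrightarrow>
     compactin weak_topology (weak_topology closure_of (blinfun_apply T ` cball 0 1))"

text \<open>HOL cannot quantify over all index types inside a definition. Nets in \<open>'x\<close> are therefore
  indexed by directed subsets of \<open>'x \<times> 'x set\<close>, and their subnets by directed subsets of the
  product of that type with \<open>'e set\<close>. This loses no generality: \<open>un_compact_op_net\<close> and
  \<open>uaw_compact_op_net\<close> below cover nets over any index type, and \<open>un_compact_opI\<close> and
  \<open>uaw_compact_opI\<close> allow subnets over any index type.\<close>

definition un_compact_op :: "('x :: real_normed_vector \<Rightarrow>\<^sub>L 'e :: banach_lattice) \<Rightarrow> bool" where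
  "un_compact_op T \<longleftrightarrow>
     (\<forall>(I :: ('x \<times> 'x set) set) le (x :: 'x \<times> 'x set \<Rightarrow> 'x).
        directed I le \<and> bounded (x ` I) \<longrightarrow>
        (\<exists>(J :: (('x \<times> 'x set) \<times> 'e set) set) le' h y.
           directed J le' \<and> subnet_map J le' I le h \<and>
           un_tendsto (\<lambda>j. blinfun_apply T (x (h j))) y (net_filter J le')))"

definition uaw_compact_op :: "('x :: real_normed_vector \<Rightarrow>\<^sub>L 'e :: banach_lattice) \<Rightarrow> bool" where
  "uaw_compact_op T \<longleftrightarrow>
     (\<forall>(I :: ('x \<times> 'x set) set) le (x :: 'x \<times> 'x set \<Rightarrow> 'x).
        directed I le \<and> bounded (x ` I) \<longrightarrow>
        (\<exists>(J :: (('x \<times> 'x set) \<times> 'e set) set) le' h y.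
           directed J le' \<and> subnet_map J le' I le h \<and>
           uaw_tendsto (\<lambda>j. blinfun_apply T (x (h j))) y (net_filter J le')))"

definition seq_un_compact_op :: "('x :: real_normed_vector \<Rightarrow>\<^sub>L 'e :: banach_lattice) \<Rightarrow> bool" where
  "seq_un_compact_op T \<longleftrightarrow>
     (\<forall>x :: nat \<Rightarrow> 'x. bounded (range x) \<longrightarrow>
        (\<exists>r y. strict_mono r \<and> un_tendsto (\<lambda>n. blinfun_apply T (x (r n))) y sequentially))"

definition seq_uaw_compact_op :: "('x :: real_normed_vector \<Rightarrow>\<^sub>L 'e :: banach_lattice) \<Rightarrow> bool" where
  "seq_uaw_compact_op T \<longleftrightarrow>
     (\<forall>x :: nat \<Rightarrow> 'x. bounded (range x) \<longrightarrow>
        (\<exists>r y. strict_mono r \<and> uaw_tendsto (\<lambda>n. blinfun_apply T (x (r n))) y sequentially))"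


section \<open>Independence of the index types\<close>

text \<open>Both convergences have the form: eventually in each member of a family \<open>B y\<close> of sets.\<close>

definition clusters :: "'e set set \<Rightarrow> 'i set \<Rightarrow> ('i \<Rightarrow> 'i \<Rightarrow> bool) \<Rightarrow> ('i \<Rightarrow> 'e) \<Rightarrow> bool" where
  "clusters B I le f \<longleftrightarrow>
     (\<forall>\<F>. finite \<F> \<and> \<F> \<subseteq> B \<longrightarrow> (\<forall>i\<in>I. \<exists>k\<in>I. le i k \<and> f k \<in> \<Inter>\<F>))"

lemma clusters_if_subnet:
  assumes J: "directed J le'" and h: "subnet_map J le' I le h"
    and conv: "\<And>U. U \<in> B \<Longrightarrow> eventually (\<lambda>j. f (h j) \<in> U) (net_filter J le')"
  shows "clusters B I le f"
  unfolding clusters_def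
proof (intro allI impI ballI)
  fix \<F> i assume \<F>: "finite \<F> \<and> \<F> \<subseteq> B" and i: "i \<in> I"
  have "eventually (\<lambda>j. \<forall>U\<in>\<F>. f (h j) \<in> U) (net_filter J le')"
    using \<F> conv by (intro eventually_ball_finite) auto
  then obtain j1 where j1: "j1 \<in> J" "\<And>j. j \<in> J \<Longrightarrow> le' j1 j \<Longrightarrow> f (h j) \<in> \<Inter>\<F>"
    unfolding eventually_net_filter[OF J] by auto
  obtain j2 where j2: "j2 \<in> J" "\<And>j. j \<in> J \<Longrightarrow> le' j2 j \<Longrightarrow> le i (h j)"
    using h i unfolding subnet_map_def by blast
  obtain j where "j \<in> J" "le' j1 j" "le' j2 j"
    using J j1(1) j2(1) unfolding directed_def by blast
  then show "\<exists>k\<in>I. le i k \<and> f k \<in> \<Inter>\<F>"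
    using j1 j2 h unfolding subnet_map_def by blast
qed

lemma subnet_if_clusters:
  fixes f :: "'i \<Rightarrow> 'e"
  assumes I: "directed I le" and cl: "clusters B I le f"
  obtains J :: "('i \<times> 'e set) set" and le' h where
    "directed J le'" "subnet_map J le' I le h"
    "\<And>U. U \<in> B \<Longrightarrow> eventually (\<lambda>j. f (h j) \<in> U) (net_filter J le')"
proof -
  define N where "N = {\<Inter>\<F> |\<F>. finite \<F> \<and> \<F> \<subseteq> B}"
  define J where "J = {(i, V). i \<in> I \<and> V \<in> N \<and> f i \<in> V}"
  define le' where "le' = (\<lambda>p q :: 'i \<times> 'e set. le (fst p) (fst q) \<and> snd q \<subseteq> snd p)"
  have fin: "\<exists>k\<in>I. le i k \<and> f k \<in> V" if "V \<in> N" "i \<in> I" for V i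
    using cl that unfolding clusters_def N_def by blast
  have N_Int: "V \<inter> W \<in> N" if VW: "V \<in> N" "W \<in> N" for V W
  proof -
    obtain \<F> \<G> where "V = \<Inter>\<F>" "finite \<F>" "\<F> \<subseteq> B" "W = \<Inter>\<G>" "finite \<G>" "\<G> \<subseteq> B"
      using VW unfolding N_def by blast
    then have "V \<inter> W = \<Inter>(\<F> \<union> \<G>)" "finite (\<F> \<union> \<G>)" "\<F> \<union> \<G> \<subseteq> B"
      by auto
    then show ?thesis
      unfolding N_def by blast
  qed
  have N_UNIV: "UNIV \<in> N"
    unfolding N_def by (intro CollectI exI[of _ "{}"]) auto
  have N_B: "U \<in> N" if "U \<in> B" for U
    using that unfolding N_def by (intro CollectI exI[of _ "{U}"]) auto
  have tr: "le i k" if "i \<in> I" "j \<in> I" "k \<in> I" "le i j" "le j k" for i j k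
    using I that unfolding directed_def by blast
  have refl: "le i i" if "i \<in> I" for i
    using I that unfolding directed_def by blast
  have ub: "\<exists>k\<in>I. le i k \<and> le j k" if "i \<in> I" "j \<in> I" for i j
    using I that unfolding directed_def by blast
  have "I \<noteq> {}"
    using I unfolding directed_def by blast
  then obtain i0 where i0: "i0 \<in> I"
    by blast
  have dirJ: "directed J le'"
    unfolding directed_def
  proof (intro conjI ballI impI)
    show "J \<noteq> {}"
      using i0 N_UNIV unfolding J_def by blast
  next
    fix p assume "p \<in> J"
    then show "le' p p"
      using refl unfolding J_def le'_def by auto
  next
    fix p q r assume "p \<in> J" "q \<in> J" "r \<in> J" "le' p q" "le' q r"
    then have "fst p \<in> I" "fst q \<in> I" "fst r \<in> I" "le (fst p) (fst q)" "le (fst q) (fst r)"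
      "snd r \<subseteq> snd p"
      unfolding J_def le'_def by fastforce+
    then show "le' p r"
      using tr[of "fst p" "fst q" "fst r"] unfolding le'_def by simp
  next
    fix p q assume pq: "p \<in> J" "q \<in> J"
    obtain i V j W where p: "p = (i, V)" and q: "q = (j, W)"
      by (metis surj_pair)
    have iV: "i \<in> I" "j \<in> I" "V \<in> N" "W \<in> N"
      using pq unfolding J_def p q by auto
    obtain k where k: "k \<in> I" "le i k" "le j k"
      using ub[OF iV(1,2)] by blast
    obtain l where l: "l \<in> I" "le k l" "f l \<in> V \<inter> W"
      using fin[OF N_Int[OF iV(3,4)] k(1)] by blast
    have "(l, V \<inter> W) \<in> J"
      using l N_Int[OF iV(3,4)] unfolding J_def by simp
    moreover have "le i l" "le j l"
      using tr[OF iV(1) k(1) l(1) k(2) l(2)] tr[OF iV(2) k(1) l(1) k(3) l(2)] .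
    then have "le' p (l, V \<inter> W)" "le' q (l, V \<inter> W)"
      unfolding le'_def p q by simp_all
    ultimately show "\<exists>r\<in>J. le' p r \<and> le' q r"
      by blast
  qed
  moreover have "subnet_map J le' I le fst"
    unfolding subnet_map_def
  proof (intro conjI ballI)
    show "fst ` J \<subseteq> I"
      unfolding J_def by auto
  next
    fix i assume "i \<in> I"
    then have "(i, UNIV) \<in> J"
      using N_UNIV unfolding J_def by auto
    moreover have "\<forall>j\<in>J. le' (i, UNIV) j \<longrightarrow> le i (fst j)"
      unfolding le'_def by auto
    ultimately show "\<exists>j0\<in>J. \<forall>j\<in>J. le' j0 j \<longrightarrow> le i (fst j)"
      by blast
  qed
  moreover have "eventually (\<lambda>j. f (fst j) \<in> U) (net_filter J le')" if U: "U \<in> B" for U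
  proof -
    obtain k where k: "k \<in> I" "f k \<in> U"
      using fin[OF N_B[OF U] i0] by blast
    then have "(k, U) \<in> J"
      using N_B[OF U] unfolding J_def by auto
    moreover have "\<forall>j\<in>J. le' (k, U) j \<longrightarrow> f (fst j) \<in> U"
      unfolding le'_def J_def by auto
    ultimately show ?thesis
      unfolding eventually_net_filter[OF dirJ] by blast
  qed
  ultimately show thesis
    by (rule that)
qed

lemma canonical_net:
  fixes x :: "'i \<Rightarrow> 'x"
  assumes I: "directed I le"
  obtains D :: "('x \<times> 'x set) set" and leD where
    "directed D leD" "fst ` D \<subseteq> x ` I"
    "\<And>B (g :: 'x \<Rightarrow> 'e). clusters B D leD (\<lambda>d. g (fst d)) \<Longrightarrow> clusters B I le (\<lambda>i. g (x i))"
proof -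
  define tl where "tl i = x ` {k\<in>I. le i k}" for i
  define D where "D = {(z, tl i) |z i. i \<in> I \<and> z \<in> tl i}"
  define leD where "leD = (\<lambda>(p :: 'x \<times> 'x set) (q :: 'x \<times> 'x set). snd q \<subseteq> snd p)"
  have self: "x i \<in> tl i" if "i \<in> I" for i
    using I that unfolding directed_def tl_def by blast
  have inD: "(x i, tl i) \<in> D" if "i \<in> I" for i
    using self that unfolding D_def by blast
  have "directed D leD"
    unfolding directed_def
  proof (intro conjI ballI impI)
    show "D \<noteq> {}"
      using inD I unfolding directed_def by blast
  next
    fix p q assume "p \<in> D" "q \<in> D"
    then obtain i j where ij: "i \<in> I" "j \<in> I" "snd p = tl i" "snd q = tl j"
      unfolding D_def by auto
    then obtain k where k: "k \<in> I" "le i k" "le j k"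
      using I unfolding directed_def by blast
    have "tl k \<subseteq> tl i" "tl k \<subseteq> tl j"
      using I ij k unfolding tl_def directed_def by blast+
    then show "\<exists>r\<in>D. leD p r \<and> leD q r"
      using inD[OF k(1)] ij unfolding leD_def by (metis snd_conv)
  qed (auto simp: leD_def)
  moreover have "fst ` D \<subseteq> x ` I"
    unfolding D_def tl_def by auto
  moreover have "clusters B I le (\<lambda>i. g (x i))"
    if cl: "clusters B D leD (\<lambda>d. g (fst d))" for B and g :: "'x \<Rightarrow> 'e"
    unfolding clusters_def
  proof (intro allI impI ballI)
    fix \<F> i assume \<F>: "finite \<F> \<and> \<F> \<subseteq> B" and i: "i \<in> I"
    obtain d where d: "d \<in> D" "leD (x i, tl i) d" "g (fst d) \<in> \<Inter>\<F>"
      using cl \<F> inD[OF i] unfolding clusters_def by blast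
    then have "fst d \<in> tl i"
      unfolding D_def leD_def by auto
    then show "\<exists>k\<in>I. le i k \<and> g (x k) \<in> \<Inter>\<F>"
      using d unfolding tl_def by auto
  qed
  ultimately show thesis
    by (rule that)
qed

definition un_nbhds :: "'e :: banach_lattice \<Rightarrow> 'e set set" where
  "un_nbhds y = {{w. norm (inf \<bar>w - y\<bar> u) < \<epsilon>} |u \<epsilon>. 0 \<le> u \<and> 0 < \<epsilon>}"

definition uaw_nbhds :: "'e :: banach_lattice \<Rightarrow> 'e set set" where
  "uaw_nbhds y = {{w. \<bar>blinfun_apply \<phi> (inf \<bar>w - y\<bar> u)\<bar> < \<epsilon>} |u \<epsilon> (\<phi> :: 'e \<Rightarrow>\<^sub>L real).
     0 \<le> u \<and> 0 < \<epsilon>}"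

lemma un_tendsto_iff_nbhds:
  "un_tendsto f y F \<longleftrightarrow> (\<forall>U\<in>un_nbhds y. eventually (\<lambda>i. f i \<in> U) F)"
proof
  assume L: "un_tendsto f y F"
  show "\<forall>U\<in>un_nbhds y. eventually (\<lambda>i. f i \<in> U) F"
    using L unfolding un_nbhds_def un_tendsto_def tendsto_iff dist_real_def by auto
next
  assume R: "\<forall>U\<in>un_nbhds y. eventually (\<lambda>i. f i \<in> U) F"
  have "eventually (\<lambda>i. f i \<in> {w. norm (inf \<bar>w - y\<bar> u) < \<epsilon>}) F" if "0 \<le> u" "0 < \<epsilon>" for u \<epsilon>
    using that by (intro R[rule_format]) (auto simp: un_nbhds_def)
  then show "un_tendsto f y F"
    unfolding un_tendsto_def tendsto_iff dist_real_def by simp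
qed

lemma uaw_tendsto_iff_nbhds:
  fixes y :: "'e :: banach_lattice"
  shows "uaw_tendsto f y F \<longleftrightarrow> (\<forall>U\<in>uaw_nbhds y. eventually (\<lambda>i. f i \<in> U) F)"
proof
  assume L: "uaw_tendsto f y F"
  show "\<forall>U\<in>uaw_nbhds y. eventually (\<lambda>i. f i \<in> U) F"
    using L unfolding uaw_nbhds_def uaw_tendsto_def limitin_weak_topology_iff tendsto_iff dist_real_def
    by (auto simp: blinfun.zero_right)
next
  assume R: "\<forall>U\<in>uaw_nbhds y. eventually (\<lambda>i. f i \<in> U) F"
  have "eventually (\<lambda>i. f i \<in> {w. \<bar>blinfun_apply \<phi> (inf \<bar>w - y\<bar> u)\<bar> < \<epsilon>}) F"
    if "0 \<le> u" "0 < \<epsilon>" for u \<epsilon> and \<phi> :: "'e \<Rightarrow>\<^sub>L real"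
    using that by (intro R[rule_format]) (unfold uaw_nbhds_def, blast)
  then show "uaw_tendsto f y F"
    unfolding uaw_tendsto_def limitin_weak_topology_iff tendsto_iff dist_real_def
    by (simp add: blinfun.zero_right)
qed

theorem un_compact_op_net:
  fixes T :: "'x :: real_normed_vector \<Rightarrow>\<^sub>L 'e :: banach_lattice" and x :: "'i \<Rightarrow> 'x"
  assumes T: "un_compact_op T" and I: "directed I le" and bd: "bounded (x ` I)"
  shows "\<exists>(J :: ('i \<times> 'e set) set) le' h y. directed J le' \<and> subnet_map J le' I le h \<and>
    un_tendsto (\<lambda>j. blinfun_apply T (x (h j))) y (net_filter J le')"
proof -
  obtain D :: "('x \<times> 'x set) set" and leD where D: "directed D leD" "fst ` D \<subseteq> x ` I"
    and cl: "\<And>B (g :: 'x \<Rightarrow> 'e). clusters B D leD (\<lambda>d. g (fst d)) \<Longrightarrow> clusters B I le (\<lambda>i. g (x i))"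
    by (rule canonical_net[OF I, where x = x and 'e = 'e]) (rule that)
  obtain J :: "(('x \<times> 'x set) \<times> 'e set) set" and le' h y where
    J: "directed J le'" "subnet_map J le' D leD h"
    and conv: "un_tendsto (\<lambda>j. blinfun_apply T (fst (h j))) y (net_filter J le')"
    using T[unfolded un_compact_op_def, rule_format, OF conjI, OF D(1) bounded_subset[OF bd D(2)]]
    by (elim exE conjE) (rule that)
  have "clusters (un_nbhds y) D leD (\<lambda>d. blinfun_apply T (fst d))"
    using conv by (intro clusters_if_subnet[OF J]) (simp add: un_tendsto_iff_nbhds)
  note c = cl[OF this]
  obtain J :: "('i \<times> 'e set) set" and le' h where J: "directed J le'" "subnet_map J le' I le h"
    and ev: "\<And>U. U \<in> un_nbhds y \<Longrightarrow> eventually (\<lambda>j. blinfun_apply T (x (h j)) \<in> U) (net_filter J le')"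
    by (rule subnet_if_clusters[OF I c]) (rule that)
  have conv: "un_tendsto (\<lambda>j. blinfun_apply T (x (h j))) y (net_filter J le')"
    using ev by (simp add: un_tendsto_iff_nbhds)
  show ?thesis
    by (intro exI conjI) (rule J(1), rule J(2), rule conv)
qed

theorem un_compact_opI:
  fixes T :: "'x :: real_normed_vector \<Rightarrow>\<^sub>L 'e :: banach_lattice"
  assumes "\<And>(I :: ('x \<times> 'x set) set) le (x :: 'x \<times> 'x set \<Rightarrow> 'x).
    directed I le \<Longrightarrow> bounded (x ` I) \<Longrightarrow>
    \<exists>(J :: 'j set) le' h y. directed J le' \<and> subnet_map J le' I le h \<and>
      un_tendsto (\<lambda>j. blinfun_apply T (x (h j))) y (net_filter J le')"
  shows "un_compact_op T"
  unfolding un_compact_op_def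
proof (intro allI impI, elim conjE)
  fix I :: "('x \<times> 'x set) set" and le and x :: "'x \<times> 'x set \<Rightarrow> 'x"
  assume I: "directed I le" and bd: "bounded (x ` I)"
  obtain J :: "'j set" and le' h y where J: "directed J le'" "subnet_map J le' I le h"
    and conv: "un_tendsto (\<lambda>j. blinfun_apply T (x (h j))) y (net_filter J le')"
    using assms[OF I bd] by (elim exE conjE) (rule that)
  have c: "clusters (un_nbhds y) I le (\<lambda>i. blinfun_apply T (x i))"
    using conv by (intro clusters_if_subnet[OF J]) (simp add: un_tendsto_iff_nbhds)
  obtain J' :: "(('x \<times> 'x set) \<times> 'e set) set" and le'' h' where
    J': "directed J' le''" "subnet_map J' le'' I le h'"
    and ev: "\<And>U. U \<in> un_nbhds y \<Longrightarrow> eventually (\<lambda>j. blinfun_apply T (x (h' j)) \<in> U) (net_filter J' le'')"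
    by (rule subnet_if_clusters[OF I c]) (rule that)
  have conv': "un_tendsto (\<lambda>j. blinfun_apply T (x (h' j))) y (net_filter J' le'')"
    using ev by (simp add: un_tendsto_iff_nbhds)
  show "\<exists>(J :: (('x \<times> 'x set) \<times> 'e set) set) le' h y.
      directed J le' \<and> subnet_map J le' I le h \<and>
      un_tendsto (\<lambda>j. blinfun_apply T (x (h j))) y (net_filter J le')"
    by (intro exI conjI) (rule J'(1), rule J'(2), rule conv')
qed

theorem uaw_compact_op_net:
  fixes T :: "'x :: real_normed_vector \<Rightarrow>\<^sub>L 'e :: banach_lattice" and x :: "'i \<Rightarrow> 'x"
  assumes T: "uaw_compact_op T" and I: "directed I le" and bd: "bounded (x ` I)"
  shows "\<exists>(J :: ('i \<times> 'e set) set) le' h y. directed J le' \<and> subnet_map J le' I le h \<and>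
    uaw_tendsto (\<lambda>j. blinfun_apply T (x (h j))) y (net_filter J le')"
proof -
  obtain D :: "('x \<times> 'x set) set" and leD where D: "directed D leD" "fst ` D \<subseteq> x ` I"
    and cl: "\<And>B (g :: 'x \<Rightarrow> 'e). clusters B D leD (\<lambda>d. g (fst d)) \<Longrightarrow> clusters B I le (\<lambda>i. g (x i))"
    by (rule canonical_net[OF I, where x = x and 'e = 'e]) (rule that)
  obtain J :: "(('x \<times> 'x set) \<times> 'e set) set" and le' h y where
    J: "directed J le'" "subnet_map J le' D leD h"
    and conv: "uaw_tendsto (\<lambda>j. blinfun_apply T (fst (h j))) y (net_filter J le')"
    using T[unfolded uaw_compact_op_def, rule_format, OF conjI, OF D(1) bounded_subset[OF bd D(2)]]
    by (elim exE conjE) (rule that)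
  have "clusters (uaw_nbhds y) D leD (\<lambda>d. blinfun_apply T (fst d))"
    using conv by (intro clusters_if_subnet[OF J]) (simp add: uaw_tendsto_iff_nbhds)
  note c = cl[OF this]
  obtain J :: "('i \<times> 'e set) set" and le' h where J: "directed J le'" "subnet_map J le' I le h"
    and ev: "\<And>U. U \<in> uaw_nbhds y \<Longrightarrow> eventually (\<lambda>j. blinfun_apply T (x (h j)) \<in> U) (net_filter J le')"
    by (rule subnet_if_clusters[OF I c]) (rule that)
  have conv: "uaw_tendsto (\<lambda>j. blinfun_apply T (x (h j))) y (net_filter J le')"
    using ev by (simp add: uaw_tendsto_iff_nbhds)
  show ?thesis
    by (intro exI conjI) (rule J(1), rule J(2), rule conv)
qed

theorem uaw_compact_opI:
  fixes T :: "'x :: real_normed_vector \<Rightarrow>\<^sub>L 'e :: banach_lattice"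
  assumes "\<And>(I :: ('x \<times> 'x set) set) le (x :: 'x \<times> 'x set \<Rightarrow> 'x).
    directed I le \<Longrightarrow> bounded (x ` I) \<Longrightarrow>
    \<exists>(J :: 'j set) le' h y. directed J le' \<and> subnet_map J le' I le h \<and>
      uaw_tendsto (\<lambda>j. blinfun_apply T (x (h j))) y (net_filter J le')"
  shows "uaw_compact_op T"
  unfolding uaw_compact_op_def
proof (intro allI impI, elim conjE)
  fix I :: "('x \<times> 'x set) set" and le and x :: "'x \<times> 'x set \<Rightarrow> 'x"
  assume I: "directed I le" and bd: "bounded (x ` I)"
  obtain J :: "'j set" and le' h y where J: "directed J le'" "subnet_map J le' I le h"
    and conv: "uaw_tendsto (\<lambda>j. blinfun_apply T (x (h j))) y (net_filter J le')"
    using assms[OF I bd] by (elim exE conjE) (rule that)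
  have c: "clusters (uaw_nbhds y) I le (\<lambda>i. blinfun_apply T (x i))"
    using conv by (intro clusters_if_subnet[OF J]) (simp add: uaw_tendsto_iff_nbhds)
  obtain J' :: "(('x \<times> 'x set) \<times> 'e set) set" and le'' h' where
    J': "directed J' le''" "subnet_map J' le'' I le h'"
    and ev: "\<And>U. U \<in> uaw_nbhds y \<Longrightarrow> eventually (\<lambda>j. blinfun_apply T (x (h' j)) \<in> U) (net_filter J' le'')"
    by (rule subnet_if_clusters[OF I c]) (rule that)
  have conv': "uaw_tendsto (\<lambda>j. blinfun_apply T (x (h' j))) y (net_filter J' le'')"
    using ev by (simp add: uaw_tendsto_iff_nbhds)
  show "\<exists>(J :: (('x \<times> 'x set) \<times> 'e set) set) le' h y.
      directed J le' \<and> subnet_map J le' I le h \<and>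
      uaw_tendsto (\<lambda>j. blinfun_apply T (x (h j))) y (net_filter J le')"
    by (intro exI conjI) (rule J'(1), rule J'(2), rule conv')
qed

end

theory Submission
  imports Defs
begin

text \<open>If \<open>E'\<close> is order continuous, then for every positive functional \<open>f\<close> and \<open>e > 0\<close> there is
  \<open>u \<ge> 0\<close> with \<open>f ((\<bar>x\<bar> - u)\<^sup>+) \<le> e\<close> for all \<open>x\<close> in the unit ball. Hence bounded \<open>uaw\<close>-convergent nets
  converge weakly, and weak compactness of \<open>T\<close> follows, for nets by comparing the weak limit with
  a point of the closure of the image of the ball in \<open>\<real>\<^bsup>E'\<^esup>\<close>, and for sequences by the
  Eberlein-Smulian theorem. Conversely, weak compactness gives weakly convergent subsequences by
  the same theorem, and these converge \<open>uaw\<close> once the lattice operations are sequentially weakly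
  continuous. If \<open>E\<close> is discrete and order continuous, every \<open>u \<ge> 0\<close> is approximated in norm by
  elements below a finite sum of multiples of atoms, on which \<open>\<bar>x\<bar> \<and> u\<close> is controlled by finitely
  many coordinate functionals; so weak convergence implies \<open>un\<close>-convergence.\<close>


section \<open>The Hahn-Banach theorem\<close>

text \<open>The unit vectors of \<open>l^1\<close> show what order continuity of the dual excludes:
  they tend to 0 in the un sense but not weakly, since a functional can see mass that leaves every
  order interval. The bound on the excess over \<open>u\<close> says that each positive functional
  neglects such mass uniformly on bounded sets. Limit points are sought in the space of all real
  functions on the dual, with the product topology, because \<open>eval_at\<close> makes the weak
  topology a pullback of it. There Tychonoff's theorem makes the closure of a bounded set compact,
  and weak compactness reduces to the claim that every point of this closure is an evaluation. A net
  can be chosen to converge to such a point, but in general a sequence cannot; this is why the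
  sequential case takes a detour. The hypothesis of part (2) concerns sequences, and so does its
  conclusion. In part (4) weak convergence implies un-convergence along every filter, which yields
  the forms for nets and for sequences together.\<close>

definition sublinear :: "('a :: real_vector \<Rightarrow> real) \<Rightarrow> bool" where
  "sublinear q \<longleftrightarrow> (\<forall>x y. q (x + y) \<le> q x + q y) \<and> (\<forall>c\<ge>0. \<forall>x. q (c *\<^sub>R x) \<le> c * q x)"

text \<open>The definition asks only for an inequality, the form in which homogeneity passes to
  infima. Applying it to the factor \<open>inverse c\<close> reverses it.\<close>

lemma sublinear_scaleR:
  assumes "sublinear q" "0 \<le> c"
  shows "q (c *\<^sub>R x) = c * q x"
proof (cases "c = 0")
  case True
  have "q (0 *\<^sub>R x) \<le> 0 * q x" "q (0 + 0) \<le> q 0 + q 0"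
    using assms(1) unfolding sublinear_def by blast+
  then show ?thesis using True by simp
next
  case False
  have le: "q (d *\<^sub>R y) \<le> d * q y" if "0 \<le> d" for d y
    using assms(1) that unfolding sublinear_def by blast
  have "q x \<le> inverse c * q (c *\<^sub>R x)"
    using le[of "inverse c" "c *\<^sub>R x"] False assms(2) by simp
  then have "c * q x \<le> q (c *\<^sub>R x)"
    using False assms(2) by (simp add: field_simps)
  then show ?thesis using le[OF assms(2)] by (meson antisym)
qed

lemma sublinear_0: "sublinear q \<Longrightarrow> q 0 = 0"
  using sublinear_scaleR[of q 0 0] by simp

lemma sublinear_lower: "sublinear q \<Longrightarrow> - q (- x) \<le> q x"
proof -
  assume q: "sublinear q"
  then have "q (x + - x) \<le> q x + q (- x)"
    unfolding sublinear_def by blast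
  then show ?thesis using sublinear_0[OF q] by simp
qed

text \<open>The infimum of \<open>q (x + t y) - t q y\<close> over \<open>t \<ge> 0\<close> is
  finite because \<open>t q y = q (t y) \<le> q (x + t y) + q (- x)\<close>. The choice
  \<open>t = 0\<close> puts it below \<open>q\<close>, and \<open>t = 1\<close> at the point
  \<open>- y\<close> gives the last bound. A sublinear functional with
  \<open>- q y < q (- y)\<close> for some \<open>y\<close> can thus be made strictly
  smaller.\<close>

lemma sublinear_shift:
  assumes q: "sublinear q"
  obtains r where "sublinear r" "r \<le> q" "r (- y) \<le> - q y"
proof -
  define h where "h x t = q (x + t *\<^sub>R y) - t * q y" for x t
  define r where "r x = (INF t\<in>{0..}. h x t)" for x
  have add: "q (x + z) \<le> q x + q z" for x z
    using q unfolding sublinear_def by blast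
  have lower: "- q (- x) \<le> h x t" if "0 \<le> t" for x t
    using add[of "x + t *\<^sub>R y" "- x"] sublinear_scaleR[OF q that, of y] unfolding h_def by simp
  have bdd: "bdd_below (h x ` {0..})" for x
    using lower by (intro bdd_belowI[of _ "- q (- x)"]) auto
  have r_le: "r x \<le> h x t" if "0 \<le> t" for x t
    unfolding r_def using that by (intro cINF_lower bdd) auto
  have r_ge: "b \<le> r x" if "\<And>t. 0 \<le> t \<Longrightarrow> b \<le> h x t" for b x
    unfolding r_def using that by (intro cINF_greatest) auto
  have "r (x + z) \<le> r x + r z" for x z
  proof -
    have "r (x + z) \<le> h x s + h z t" if "0 \<le> s" "0 \<le> t" for s t
    proof -
      have "r (x + z) \<le> h (x + z) (s + t)"
        using that by (intro r_le) simp
      also have "\<dots> \<le> h x s + h z t"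
        using add[of "x + s *\<^sub>R y" "z + t *\<^sub>R y"] unfolding h_def by (simp add: algebra_simps)
      finally show ?thesis .
    qed
    then have "r (x + z) - h x s \<le> r z" if "0 \<le> s" for s
      using that by (intro r_ge) (simp add: algebra_simps)
    then have "r (x + z) - r z \<le> r x"
      by (intro r_ge) (simp add: algebra_simps)
    then show ?thesis by simp
  qed
  moreover have "r (c *\<^sub>R x) \<le> c * r x" if c: "0 \<le> c" for c x
  proof (cases "c = 0")
    case True
    then show ?thesis
      using r_le[of 0 0] sublinear_0[OF q] unfolding h_def by simp
  next
    case False
    have "r (c *\<^sub>R x) / c \<le> h x t" if "0 \<le> t" for t
    proof -
      have "r (c *\<^sub>R x) \<le> h (c *\<^sub>R x) (c * t)"
        using that c by (intro r_le) simp
      also have "\<dots> = c * h x t"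
        using sublinear_scaleR[OF q c, of "x + t *\<^sub>R y"] unfolding h_def
        by (simp add: algebra_simps)
      finally show ?thesis using False c by (simp add: field_simps)
    qed
    then have "r (c *\<^sub>R x) / c \<le> r x" by (rule r_ge)
    then show ?thesis using False c by (simp add: field_simps)
  qed
  ultimately have "sublinear r"
    unfolding sublinear_def by blast
  moreover have "r \<le> q"
    using r_le[of 0] unfolding h_def by (intro le_funI) simp
  moreover have "r (- y) \<le> - q y"
    using r_le[of 1 "- y"] sublinear_0[OF q] unfolding h_def by simp
  ultimately show thesis by (rule that)
qed

text \<open>The linear functionals are the minimal sublinear ones, so Zorn's lemma yields the
  Hahn-Banach theorem without extending functionals from subspaces.\<close>

theorem sublinear_support:
  fixes p :: "'a :: real_vector \<Rightarrow> real"
  assumes p: "sublinear p"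
  obtains f where "linear f" "\<And>x. f x \<le> p x" "f y = p y"
proof -
  \<comment> \<open>Every linear \<open>f\<close> below \<open>p'\<close> satisfies
    \<open>f (- y) \<le> - p y\<close>, so it touches \<open>p\<close> at \<open>y\<close>. Starting
    Zorn's lemma from \<open>p'\<close> instead of \<open>p\<close> secures \<open>f y = p y\<close>
    in advance.\<close>
  obtain p' where p': "sublinear p'" "p' \<le> p" "p' (- y) \<le> - p y"
    by (rule sublinear_shift[OF p, of y]) (rule that)
  define A where "A = {q. sublinear q \<and> q \<le> p'}"
  \<comment> \<open>The order is reversed, so that the maximal element delivered by
    \<open>predicate_Zorn\<close> is a minimal sublinear functional.\<close>
  let ?P = "\<lambda>q r :: 'a \<Rightarrow> real. r \<le> q"
  have "partial_order_on A (relation_of ?P A)"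
    by (auto simp: partial_order_on_def preorder_on_def refl_on_def trans_def antisym_def
        relation_of_def)
  moreover have "\<exists>u\<in>A. \<forall>a\<in>C. u \<le> a" if C: "C \<in> Chains (relation_of ?P A)" for C
  proof (cases "C = {}")
    case True
    then show ?thesis using p'(1) unfolding A_def by auto
  next
    case False
    have CA: "q \<in> A" and tot: "q \<le> r \<or> r \<le> q" if "q \<in> C" "r \<in> C" for q r
      using C that unfolding Chains_def relation_of_def by auto
    define u where "u x = (INF q\<in>C. q x)" for x
    have "- p' (- x) \<le> q x" if "q \<in> C" for q x
      using sublinear_lower[of q x] CA[OF that that] unfolding A_def le_fun_def
      by (smt (verit) mem_Collect_eq)
    then have bdd: "bdd_below ((\<lambda>q. q x) ` C)" for x
      by (intro bdd_belowI[of _ "- p' (- x)"]) auto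
    have u_le: "u x \<le> q x" if "q \<in> C" for q x
      unfolding u_def using that by (intro cINF_lower bdd)
    have u_ge: "b \<le> u x" if "\<And>q. q \<in> C \<Longrightarrow> b \<le> q x" for b x
      unfolding u_def using that False by (intro cINF_greatest) auto
    have "u (x + z) \<le> u x + u z" for x z
    proof -
      have "u (x + z) \<le> q x + r z" if qr: "q \<in> C" "r \<in> C" for q r
      proof -
        obtain s where s: "s \<in> C" "s \<le> q" "s \<le> r"
          using tot[OF qr] qr by blast
        have "u (x + z) \<le> s (x + z)" using s(1) by (rule u_le)
        also have "\<dots> \<le> s x + s z"
          using CA[OF s(1) s(1)] unfolding A_def sublinear_def by blast
        also have "\<dots> \<le> q x + r z"
          using s(2,3) by (intro add_mono) (auto simp: le_fun_def)
        finally show ?thesis .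
      qed
      then have "u (x + z) - q x \<le> u z" if "q \<in> C" for q
        using that by (intro u_ge) (simp add: diff_le_eq add.commute[of _ "q x"])
      then have "u (x + z) - u z \<le> u x"
        by (intro u_ge) (simp add: algebra_simps)
      then show ?thesis by simp
    qed
    moreover have "u (c *\<^sub>R x) \<le> c * u x" if c: "0 \<le> c" for c x
    proof (cases "c = 0")
      case True
      obtain q where "q \<in> C" using False by blast
      then have "u 0 \<le> 0"
        using u_le[of q 0] CA[of q q] sublinear_0[of q] unfolding A_def by auto
      then show ?thesis using True by simp
    next
      case False
      have "u (c *\<^sub>R x) / c \<le> q x" if "q \<in> C" for q
        using u_le[OF that, of "c *\<^sub>R x"] sublinear_scaleR[of q c x] CA[OF that that] c False
        unfolding A_def by (simp add: field_simps)
      then have "u (c *\<^sub>R x) / c \<le> u x" by (rule u_ge)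
      then show ?thesis using False c by (simp add: field_simps)
    qed
    ultimately have "sublinear u"
      unfolding sublinear_def by blast
    moreover obtain q where "q \<in> C" using False by blast
    then have "u \<le> p'"
      using u_le CA unfolding A_def le_fun_def by (blast intro: order_trans)
    ultimately show ?thesis
      using u_le unfolding A_def by (auto simp: le_fun_def)
  qed
  ultimately obtain f where f: "f \<in> A" and min: "\<And>q. q \<in> A \<Longrightarrow> q \<le> f \<Longrightarrow> q = f"
    using predicate_Zorn[of A ?P] by blast
  have sf: "sublinear f" and fp: "f \<le> p'"
    using f unfolding A_def by auto
  \<comment> \<open>Shifting \<open>f\<close> at \<open>x\<close> produces a sublinear functional
    below \<open>f\<close>, which is \<open>f\<close> itself by minimality; hence \<open>f\<close>
    is odd. An odd subadditive function is additive, by subadditivity at \<open>x, z\<close> and at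
    \<open>- x, - z\<close>.\<close>
  have neg: "f (- x) = - f x" for x
  proof -
    obtain r where r: "sublinear r" "r \<le> f" "r (- x) \<le> - f x"
      by (rule sublinear_shift[OF sf, of x]) (rule that)
    have "r = f"
      using r fp by (intro min) (auto simp: A_def)
    then show ?thesis
      using r(3) sublinear_lower[OF sf, of "- x"] by simp
  qed
  have le: "f (x + z) \<le> f x + f z" for x z
    using sf unfolding sublinear_def by blast
  have "f (x + z) = f x + f z" for x z
    using le[of x z] le[of "- x" "- z"] neg[of "x + z"] neg[of x] neg[of z] by simp
  moreover have "f (c *\<^sub>R x) = c *\<^sub>R f x" for c x
    using sublinear_scaleR[OF sf, of c x] sublinear_scaleR[OF sf, of "- c" x] neg[of "c *\<^sub>R x"]
    by (cases "0 \<le> c") auto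
  ultimately have "linear f" by (rule linearI)
  moreover have "f x \<le> p x" for x
    using fp p'(2) by (auto simp: le_fun_def intro: order_trans)
  moreover have "f y = p y"
    using fp p'(3) neg[of y] calculation(2)[of y] by (auto simp: le_fun_def intro: antisym)
      (smt (verit, ccfv_threshold))
  ultimately show thesis by (rule that)
qed

section \<open>Separation of a point from a subspace\<close>

lemma infdist_sublinear:
  fixes S :: "'a :: real_normed_vector set"
  assumes S: "subspace S"
  shows "sublinear (\<lambda>x. infdist x S)"
proof -
  have ne: "S \<noteq> {}" using subspace_0[OF S] by blast
  have le: "infdist x S \<le> norm (x - s)" if "s \<in> S" for x s
    using infdist_le[OF that, of x] by (simp add: dist_norm)
  have approx: "\<exists>s\<in>S. norm (x - s) < infdist x S + e" if "0 < e" for x e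
    using cINF_less_iff[OF ne bdd_belowI2[of S 0 "dist x"], of "infdist x S + e"] that
    by (simp add: infdist_notempty[OF ne] dist_norm)
  have "infdist (x + y) S \<le> infdist x S + infdist y S" for x y
  proof (rule field_le_epsilon)
    fix e :: real assume "0 < e"
    then obtain s t where st: "s \<in> S" "t \<in> S" "norm (x - s) < infdist x S + e / 2"
      "norm (y - t) < infdist y S + e / 2"
      using approx[of "e / 2"] by (meson half_gt_zero)
    have "infdist (x + y) S \<le> norm ((x + y) - (s + t))"
      using st S by (intro le subspace_add)
    also have "\<dots> \<le> norm (x - s) + norm (y - t)"
      using norm_triangle_ineq[of "x - s" "y - t"] by (simp add: algebra_simps)
    finally show "infdist (x + y) S \<le> infdist x S + infdist y S + e"
      using st by simp
  qed
  moreover have "infdist (c *\<^sub>R x) S \<le> c * infdist x S" if c: "0 \<le> c" for c x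
  proof (rule field_le_epsilon)
    fix e :: real assume "0 < e"
    then have "0 < e / (c + 1)" using c by simp
    then obtain s where s: "s \<in> S" "norm (x - s) < infdist x S + e / (c + 1)"
      using approx by blast
    have "infdist (c *\<^sub>R x) S \<le> norm (c *\<^sub>R x - c *\<^sub>R s)"
      using s S by (intro le subspace_scale)
    also have "\<dots> = c * norm (x - s)"
      using c by (metis scaleR_diff_right norm_scaleR abs_of_nonneg)
    also have "\<dots> \<le> c * (infdist x S + e / (c + 1))"
      using s c by (intro mult_left_mono) auto
    also have "\<dots> = c * infdist x S + e * (c / (c + 1))"
      by (simp add: algebra_simps)
    also have "\<dots> \<le> c * infdist x S + e * 1"
      using c \<open>0 < e\<close> by (intro add_left_mono mult_left_mono) auto
    finally show "infdist (c *\<^sub>R x) S \<le> c * infdist x S + e" by simp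
  qed
  ultimately show ?thesis
    unfolding sublinear_def by blast
qed

text \<open>A linear functional supporting the distance function at \<open>y\<close> does
  everything: the distance is at most the norm, which bounds the functional by 1, and it is 0 on
  \<open>S\<close>, which forces the functional to be both nonpositive and odd there.\<close>

lemma subspace_separation:
  fixes S :: "'a :: real_normed_vector set"
  assumes S: "subspace S"
  obtains \<phi> :: "'a \<Rightarrow>\<^sub>L real" where "norm \<phi> \<le> 1" "\<And>s. s \<in> S \<Longrightarrow> \<phi> s = 0" "\<phi> y = infdist y S"
proof -
  obtain f where f: "linear f" "\<And>x. f x \<le> infdist x S" "f y = infdist y S"
    by (rule sublinear_support[OF infdist_sublinear[OF S], of y]) (rule that)
  have neg: "f (- x) = - f x" for x
    using f(1) by (rule linear_neg)
  have "infdist x S \<le> norm x" for x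
    using infdist_le[OF subspace_0[OF S], of x] by (simp add: dist_norm)
  then have bd: "\<bar>f x\<bar> \<le> norm x" for x
    using f(2)[of x] f(2)[of "- x"] neg[of x] by (smt (verit) norm_minus_cancel)
  then have "bounded_linear f"
    using f(1) by (intro bounded_linear.intro bounded_linear_axioms.intro exI[of _ 1])
      (auto simp: linear_iff linearI)
  then have app: "blinfun_apply (Blinfun f) = f"
    by (rule bounded_linear_Blinfun_apply)
  have "f s = 0" if "s \<in> S" for s
    using f(2)[of s] f(2)[of "- s"] neg[of s] that subspace_neg[OF S that] by simp
  moreover have "norm (Blinfun f) \<le> 1"
    using bd by (intro norm_blinfun_bound) (auto simp: app)
  ultimately show thesis
    using f(3) by (intro that[of "Blinfun f"]) (auto simp: app)
qed

lemma norming_functional: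
  fixes x :: "'a :: real_normed_vector"
  obtains \<phi> :: "'a \<Rightarrow>\<^sub>L real" where "norm \<phi> \<le> 1" "\<phi> x = norm x"
  using subspace_separation[OF subspace_single_0, of x] by (auto simp: dist_norm infdist_def)


section \<open>Weak topology and the Eberlein-Smulian theorem\<close>

abbreviation (input) eval_at :: "'a :: real_normed_vector \<Rightarrow> ('a \<Rightarrow>\<^sub>L real) \<Rightarrow> real" where
  "eval_at x \<equiv> \<lambda>\<phi>. blinfun_apply \<phi> x"

lemma continuous_map_eval_at: "continuous_map weak_topology euclidean eval_at"
  using continuous_map_pullback[of euclidean euclidean id UNIV eval_at]
  unfolding weak_topology_def by simp

lemma continuous_map_blinfun_weak:
  "continuous_map weak_topology euclidean (blinfun_apply (\<phi> :: 'a :: real_normed_vector \<Rightarrow>\<^sub>L real))"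
proof -
  have "continuous_map weak_topology euclidean ((\<lambda>g. g \<phi>) \<circ> (eval_at :: 'a \<Rightarrow> _))"
    by (intro continuous_map_compose[OF continuous_map_eval_at]) simp
  then show ?thesis by (simp add: o_def)
qed

lemma open_finite_approx:
  fixes \<Psi> :: "'i \<Rightarrow> real"
  assumes "finite F"
  shows "open {g. \<forall>\<phi>\<in>F. \<bar>g \<phi> - \<Psi> \<phi>\<bar> < e}"
proof -
  have "{g. \<forall>\<phi>\<in>F. \<bar>g \<phi> - \<Psi> \<phi>\<bar> < e} = (\<Inter>\<phi>\<in>F. {g. \<bar>g \<phi> - \<Psi> \<phi>\<bar> < e})"
    by auto
  moreover have "open {g. \<bar>g \<phi> - \<Psi> \<phi>\<bar> < e}" for \<phi>
    by (intro open_Collect_less continuous_intros continuous_on_product_coordinates)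
  ultimately show ?thesis using assms by auto
qed

lemma closure_eval_at_approx:
  assumes "\<Psi> \<in> closure (eval_at ` A)" "finite F" "0 < e"
  shows "\<exists>a\<in>A. \<forall>\<phi>\<in>F. \<bar>blinfun_apply \<phi> a - \<Psi> \<phi>\<bar> < e"
proof -
  have "\<Psi> \<in> {g. \<forall>\<phi>\<in>F. \<bar>g \<phi> - \<Psi> \<phi>\<bar> < e}" using assms by simp
  then have "{g. \<forall>\<phi>\<in>F. \<bar>g \<phi> - \<Psi> \<phi>\<bar> < e} \<inter> eval_at ` A \<noteq> {}"
    using assms(1) open_Int_closure_eq_empty[OF open_finite_approx[OF assms(2), of \<Psi> e], of "eval_at ` A"]
    by blast
  then show ?thesis by auto
qed

text \<open>The closure \<open>C\<close> of the evaluations lies in a product of compact intervals,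
  so it is compact. Since all its points are evaluations and the weak topology is a pullback, an
  open cover of the preimage of \<open>C\<close> comes from an open cover of \<open>C\<close>. The
  preimage is also weakly closed, so it contains the weak closure of \<open>A\<close>.\<close>

lemma compactin_weak_closure:
  fixes A :: "'a :: real_normed_vector set"
  assumes A: "bounded A"
    and rep: "\<And>\<Psi>. \<Psi> \<in> closure (eval_at ` A) \<Longrightarrow> \<exists>x. \<Psi> = eval_at x"
  shows "compactin weak_topology (weak_topology closure_of A)"
proof -
  obtain M where M: "\<And>a. a \<in> A \<Longrightarrow> norm a \<le> M"
    using A unfolding bounded_iff by blast
  define C where "C = closure (eval_at ` A)"
  define P :: "(('a \<Rightarrow>\<^sub>L real) \<Rightarrow> real) set" where "P = (\<Pi>\<^sub>E \<phi>\<in>UNIV. cball 0 (norm \<phi> * M))"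
  have "compactin (product_topology (\<lambda>_. euclidean) UNIV) P"
    unfolding P_def by (subst compactin_PiE) auto
  then have "compact P"
    by (simp add: euclidean_product_topology)
  moreover have "closedin (product_topology (\<lambda>_. euclidean) UNIV) P"
    unfolding P_def closedin_product_topology by auto
  then have "closed P"
    by (simp add: euclidean_product_topology)
  moreover have "\<bar>blinfun_apply \<phi> a\<bar> \<le> norm \<phi> * M" if "a \<in> A" for \<phi> a
    using norm_blinfun[of \<phi> a] mult_left_mono[OF M[OF that], of "norm \<phi>"] by simp
  then have "eval_at ` A \<subseteq> P"
    unfolding P_def by (auto simp: PiE_iff)
  ultimately have "C \<subseteq> P"
    unfolding C_def by (intro closure_minimal)
  then have "compact C"
    using compact_Int_closed[OF \<open>compact P\<close>, of C] unfolding C_def by (simp add: inf.absorb2)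
  have open_pb: "openin weak_topology (eval_at -` V)" if "open V" for V :: "(('a \<Rightarrow>\<^sub>L real) \<Rightarrow> real) set"
    using that unfolding weak_topology_def openin_pullback_topology by auto
  have "compactin weak_topology (eval_at -` C :: 'a set)"
    unfolding compactin_def
  proof (intro conjI allI impI, goal_cases)
    case 1
    show ?case by simp
  next
    case (2 \<U>)
    define \<V> where "\<V> = {V. open V \<and> eval_at -` V \<in> \<U>}"
    have "C \<subseteq> \<Union>\<V>"
    proof
      fix \<Psi> assume \<Psi>: "\<Psi> \<in> C"
      then obtain x where x: "\<Psi> = eval_at x"
        using rep unfolding C_def by blast
      then obtain U where U: "U \<in> \<U>" "x \<in> U" using 2 \<Psi> by auto
      then obtain V where "open V" "U = eval_at -` V"
        using 2 unfolding weak_topology_def openin_pullback_topology by auto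
      then show "\<Psi> \<in> \<Union>\<V>"
        using U x unfolding \<V>_def by auto
    qed
    then obtain \<F> where \<F>: "\<F> \<subseteq> \<V>" "finite \<F>" "C \<subseteq> \<Union>\<F>"
      using compactE[OF \<open>compact C\<close>, of \<V>] unfolding \<V>_def by blast
    then have "eval_at -` C \<subseteq> \<Union>((\<lambda>V. eval_at -` V) ` \<F>)"
      by blast
    then show ?case
      using \<F>(1,2) by (intro exI[of _ "(\<lambda>V. eval_at -` V) ` \<F>"]) (auto simp: \<V>_def)
  qed
  moreover have "openin weak_topology (eval_at -` (- C) :: 'a set)"
    unfolding C_def by (intro open_pb) (simp add: open_Compl)
  then have "closedin weak_topology (eval_at -` C :: 'a set)"
    unfolding closedin_def by (simp add: vimage_Diff Compl_eq_Diff_UNIV)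
  then have "weak_topology closure_of A \<subseteq> eval_at -` C"
    using closure_subset[of "eval_at ` A"] unfolding C_def
    by (intro closure_of_minimal) (simp_all add: image_subset_iff_subset_vimage)
  ultimately show ?thesis
    by (rule closed_compactin) simp
qed

text \<open>The filter is arbitrary so that the lemma serves nets as well as a sequence restricted
  to an infinite set of indices. Finite sets of functionals replace the basic neighbourhoods of
  \<open>y\<close>.\<close>

lemma weak_cluster_point:
  assumes K: "compactin weak_topology K" and fK: "eventually (\<lambda>i. f i \<in> K) F" and F: "F \<noteq> bot"
  obtains y where "y \<in> K" "\<And>\<Phi> (e :: real). finite \<Phi> \<Longrightarrow> 0 < e \<Longrightarrow>
    frequently (\<lambda>i. \<forall>\<phi>\<in>\<Phi>. \<bar>blinfun_apply \<phi> (f i) - blinfun_apply \<phi> y\<bar> < e) F"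
proof -
  have "compact (eval_at ` K)"
    using image_compactin[OF K continuous_map_eval_at] by simp
  moreover have "filtermap (\<lambda>i. eval_at (f i)) F \<noteq> bot"
    using F by (simp add: filtermap_bot_iff)
  moreover have "eventually (\<lambda>g. g \<in> eval_at ` K) (filtermap (\<lambda>i. eval_at (f i)) F)"
    using fK unfolding eventually_filtermap by eventually_elim blast
  ultimately obtain y where y: "y \<in> K" "inf (nhds (eval_at y)) (filtermap (\<lambda>i. eval_at (f i)) F) \<noteq> bot"
    unfolding compact_filter by (smt (verit) imageE)
  have "frequently (\<lambda>i. \<forall>\<phi>\<in>\<Phi>. \<bar>blinfun_apply \<phi> (f i) - blinfun_apply \<phi> y\<bar> < e) F"
    if "finite \<Phi>" "0 < e" for \<Phi> and e :: real
  proof (rule ccontr)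
    let ?U = "{g. \<forall>\<phi>\<in>\<Phi>. \<bar>g \<phi> - eval_at y \<phi>\<bar> < e}"
    assume "\<not> ?thesis"
    then have fm: "eventually (\<lambda>g. g \<notin> ?U) (filtermap (\<lambda>i. eval_at (f i)) F)"
      unfolding eventually_filtermap frequently_def by simp
    have nb: "eventually (\<lambda>g. g \<in> ?U) (nhds (eval_at y))"
      using open_finite_approx[OF that(1)] that(2) by (intro eventually_nhds_in_open) auto
    have "eventually (\<lambda>g. g \<in> ?U \<and> g \<notin> ?U) (inf (nhds (eval_at y)) (filtermap (\<lambda>i. eval_at (f i)) F))"
      by (intro eventually_conj filter_leD[OF inf_le1 nb] filter_leD[OF inf_le2 fm])
    then have "eventually (\<lambda>_. False) (inf (nhds (eval_at y)) (filtermap (\<lambda>i. eval_at (f i)) F))"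
      by (rule eventually_mono) blast
    then show False using y(2) unfolding trivial_limit_def by blast
  qed
  then show thesis by (rule that[OF y(1)])
qed

text \<open>Coefficient lists are countable, so \<open>from_nat\<close> enumerates all combinations.
  The value depends only on the terms of \<open>a\<close> with index below the length of the list,
  which permits its use while \<open>a\<close> is still being constructed.\<close>

definition rat_comb :: "(nat \<Rightarrow> 'a :: real_vector) \<Rightarrow> rat list \<Rightarrow> 'a" where
  "rat_comb a l = (\<Sum>k<length l. of_rat (l ! k) *\<^sub>R a k)"

lemma rat_comb_cong: "(\<And>k. k < length l \<Longrightarrow> a k = b k) \<Longrightarrow> rat_comb a l = rat_comb b l"
  unfolding rat_comb_def by (intro sum.cong) auto

lemma rat_comb_add: "\<exists>l'. rat_comb a l' = of_rat q *\<^sub>R a k + rat_comb a l"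
proof -
  define n where "n = max (length l) (Suc k)"
  define c where "c j = (if j < length l then l ! j else 0)" for j
  have "rat_comb a (map (\<lambda>j. (if j = k then q else 0) + c j) [0..<n]) =
      (\<Sum>j<n. (if j = k then of_rat q *\<^sub>R a j else 0) + of_rat (c j) *\<^sub>R a j)"
    unfolding rat_comb_def by (auto intro!: sum.cong simp: of_rat_add scaleR_add_left)
  also have "\<dots> = (\<Sum>j<n. if j = k then of_rat q *\<^sub>R a j else 0) + (\<Sum>j<n. of_rat (c j) *\<^sub>R a j)"
    by (rule sum.distrib)
  also have "(\<Sum>j<n. if j = k then of_rat q *\<^sub>R a j else 0) = of_rat q *\<^sub>R a k"
    unfolding n_def by (subst sum.delta) (auto simp: max_def)
  also have "(\<Sum>j<n. of_rat (c j) *\<^sub>R a j) = rat_comb a l"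
    unfolding rat_comb_def c_def n_def by (intro sum.mono_neutral_cong_right) auto
  finally show ?thesis by blast
qed

lemma rat_comb_dense:
  fixes a :: "nat \<Rightarrow> 'a :: real_normed_vector"
  assumes x: "x \<in> closure (span (range a))" and e: "0 < e"
  obtains l where "norm (x - rat_comb a l) < e"
proof -
  have "\<forall>e>0. \<exists>l. norm (y - rat_comb a l) < e" if "y \<in> span (range a)" for y
    using that
  proof (induction rule: span_induct_alt)
    case base
    show ?case
      by (auto intro!: exI[of _ "[]"] simp: rat_comb_def)
  next
    case (step c x y)
    show ?case
    proof (intro allI impI)
      fix e :: real assume e: "0 < e"
      obtain k where k: "x = a k" using step(1) by blast
      obtain l where l: "norm (y - rat_comb a l) < e / 2"
        using step(2) e half_gt_zero by blast
      have "0 < e / (2 * (norm x + 1))"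
        using e by (intro divide_pos_pos mult_pos_pos add_nonneg_pos) auto
      then obtain q where "c < of_rat q" "of_rat q < c + e / (2 * (norm x + 1))"
        using of_rat_dense[of c "c + e / (2 * (norm x + 1))"] by auto
      then have q: "\<bar>c - of_rat q\<bar> < e / (2 * (norm x + 1))"
        by simp
      obtain l' where l': "rat_comb a l' = of_rat q *\<^sub>R a k + rat_comb a l"
        using rat_comb_add by blast
      have "norm ((c *\<^sub>R x + y) - rat_comb a l') = norm ((c - of_rat q) *\<^sub>R x + (y - rat_comb a l))"
        unfolding l' k by (simp add: algebra_simps)
      also have "\<dots> \<le> \<bar>c - of_rat q\<bar> * norm x + norm (y - rat_comb a l)"
        by (rule norm_triangle_le) simp
      also have "\<dots> \<le> \<bar>c - of_rat q\<bar> * (norm x + 1) + norm (y - rat_comb a l)"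
        by (intro add_right_mono mult_left_mono) auto
      also have "\<dots> < e / 2 + e / 2"
        using q l norm_ge_zero[of x] by (intro add_strict_mono) (simp_all add: field_simps)
      finally show "\<exists>l. norm ((c *\<^sub>R x + y) - rat_comb a l) < e" by auto
    qed
  qed
  moreover obtain y where "y \<in> span (range a)" "norm (x - y) < e / 2"
    using x e unfolding closure_approachable dist_norm norm_minus_commute[of x]
    by (meson half_gt_zero)
  ultimately obtain l where "norm (y - rat_comb a l) < e / 2"
    using e half_gt_zero by blast
  then have "norm (x - rat_comb a l) < e"
    using \<open>norm (x - y) < e / 2\<close> norm_triangle_ineq[of "x - y" "y - rat_comb a l"] by simp
  then show thesis by (rule that)
qed

lemma subspace_closure_diff:
  fixes S :: "'a :: real_normed_vector set"
  assumes "subspace S" "y \<in> closure S" "z \<in> closure S"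
  shows "y - z \<in> closure S"
proof -
  obtain s t where "\<And>n. s n \<in> S" "s \<longlonglongrightarrow> y" "\<And>n. t n \<in> S" "t \<longlonglongrightarrow> z"
    using assms(2,3) unfolding closure_sequential by blast
  then show ?thesis
    unfolding closure_sequential using subspace_diff[OF assms(1)]
    by (intro exI[of _ "\<lambda>n. s n - t n"]) (auto intro: tendsto_diff)
qed

text \<open>Norming functionals of a countable dense subset of the closed span separate the points
  of that span. Countably many functionals can be made to converge along one subsequence, since a
  countable product of compact sets of reals is sequentially compact. All weak cluster points of
  this subsequence lie in the closed span and agree on these functionals, so there is only one, and
  compactness turns this into weak convergence.\<close>

theorem weakly_compact_imp_seq:
  fixes a :: "nat \<Rightarrow> 'a :: real_normed_vector"
  assumes K: "compactin weak_topology K" and aK: "\<And>n. a n \<in> K"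
  obtains r y where "strict_mono r" "limitin weak_topology (\<lambda>n. a (r n)) y sequentially"
proof -
  define S where "S = span (range a)"
  define q where "q i = rat_comb a (from_nat i)" for i
  have "\<exists>\<psi>. norm \<psi> \<le> 1 \<and> blinfun_apply \<psi> (q i) = norm (q i)" for i
    by (rule norming_functional[of "q i"]) blast
  then obtain \<psi> :: "nat \<Rightarrow> 'a \<Rightarrow>\<^sub>L real" where
    \<psi>: "\<And>i. norm (\<psi> i) \<le> 1" "\<And>i. \<psi> i (q i) = norm (q i)"
    by metis
  define P where "P = (\<Pi>\<^sub>E i\<in>UNIV. blinfun_apply (\<psi> i) ` K)"
  have "compact (blinfun_apply (\<psi> i) ` K)" for i
    using image_compactin[OF K continuous_map_blinfun_weak] by simp
  then have "compactin (product_topology (\<lambda>_. euclidean) UNIV) P"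
    unfolding P_def by (subst compactin_PiE) auto
  then have "seq_compact P"
    by (intro compact_imp_seq_compact) (simp add: euclidean_product_topology)
  moreover have "(\<lambda>i. \<psi> i (a n)) \<in> P" for n
    using aK unfolding P_def by auto
  ultimately obtain l r where r: "strict_mono r"
    and lim: "((\<lambda>n i. \<psi> i (a n)) \<circ> r) \<longlonglongrightarrow> l"
    unfolding seq_compact_def by metis
  have lim: "(\<lambda>n. \<psi> i (a (r n))) \<longlonglongrightarrow> l i" for i
    using lim unfolding limitin_canonical_iff[symmetric] euclidean_product_topology[symmetric]
    by (simp add: limitin_componentwise o_def)
  \<comment> \<open>If the \<open>\<psi> i\<close> do not distinguish \<open>y\<close> from
    \<open>z\<close>, a combination \<open>q i\<close> within \<open>e\<close> of
    \<open>y - z\<close> has norm below \<open>e\<close>, because its norming functional vanishes at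
    \<open>y - z\<close>. Then \<open>norm (y - z) < 2 * e\<close>, against the choice of
    \<open>e\<close>.\<close>
  have uniq: "y = z" if yz: "y \<in> closure S" "z \<in> closure S" "\<And>i. \<psi> i y = \<psi> i z" for y z
  proof (rule ccontr)
    assume "y \<noteq> z"
    define e where "e = norm (y - z) / 2"
    have e: "0 < e" using \<open>y \<noteq> z\<close> unfolding e_def by simp
    have "y - z \<in> closure S"
      using yz unfolding S_def by (intro subspace_closure_diff) auto
    then obtain l where "norm ((y - z) - rat_comb a l) < e"
      using rat_comb_dense[OF _ e] unfolding S_def by blast
    then obtain i where i: "norm ((y - z) - q i) < e"
      unfolding q_def by (metis from_nat_to_nat)
    have "norm (q i) = \<psi> i (q i - (y - z))"
      using \<psi>(2)[of i] yz(3)[of i] by (simp add: blinfun.diff_right)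
    also have "\<dots> \<le> norm (q i - (y - z))"
      using norm_blinfun[of "\<psi> i" "q i - (y - z)"] mult_right_mono[OF \<psi>(1)[of i], of "norm (q i - (y - z))"]
      by simp
    finally show False
      using i norm_triangle_ineq[of "(y - z) - q i" "q i"] unfolding e_def
      by (simp add: norm_minus_commute)
  qed
  \<comment> \<open>Used twice: with \<open>sequentially\<close> to find the limit, and with the
    filter of indices at which a functional stays \<open>e\<close> away from that limit, to refute
    their persistence.\<close>
  have cluster: "\<exists>y\<in>closure S. (\<forall>i. \<psi> i y = l i) \<and>
      (\<forall>\<phi> (e :: real). 0 < e \<longrightarrow> frequently (\<lambda>n. \<bar>blinfun_apply \<phi> (a (r n)) - blinfun_apply \<phi> y\<bar> < e) F)"
    if F: "F \<noteq> bot" "F \<le> sequentially" for F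
  proof -
    have "eventually (\<lambda>n. a (r n) \<in> K) F" using aK by simp
    then obtain y where y: "\<And>\<Phi> (e :: real). finite \<Phi> \<Longrightarrow> 0 < e \<Longrightarrow>
        frequently (\<lambda>n. \<forall>\<phi>\<in>\<Phi>. \<bar>blinfun_apply \<phi> (a (r n)) - blinfun_apply \<phi> y\<bar> < e) F"
      by (rule weak_cluster_point[OF K _ F(1), where f = "\<lambda>n. a (r n)"]) blast
    have y: "frequently (\<lambda>n. \<bar>blinfun_apply \<phi> (a (r n)) - blinfun_apply \<phi> y\<bar> < e) F" if "0 < e" for \<phi> and e :: real
      using y[of "{\<phi>}", OF _ that] by simp
    have "y \<in> closure S"
    proof -
      obtain \<phi> :: "'a \<Rightarrow>\<^sub>L real" where \<phi>: "\<And>s. s \<in> S \<Longrightarrow> \<phi> s = 0" "\<phi> y = infdist y S"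
        by (rule subspace_separation[of S y]) (auto simp: S_def)
      have "infdist y S \<le> 0"
      proof (rule ccontr)
        assume "\<not> infdist y S \<le> 0"
        then have "frequently (\<lambda>n. \<bar>\<phi> (a (r n)) - \<phi> y\<bar> < \<phi> y) F"
          using \<phi>(2) by (intro y) simp
        then obtain n where "\<bar>\<phi> (a (r n)) - \<phi> y\<bar> < \<phi> y"
          using frequently_ex by blast
        moreover have "\<phi> (a (r n)) = 0"
          by (intro \<phi>(1)) (auto simp: S_def intro: span_base)
        ultimately show False by simp
      qed
      then have "infdist y S = 0" using infdist_nonneg[of y S] by simp
      moreover have "S \<noteq> {}" unfolding S_def using span_zero by blast
      ultimately show ?thesis by (simp add: in_closure_iff_infdist_zero)
    qed
    moreover have "\<psi> i y = l i" for i
    proof (rule ccontr)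
      assume "\<psi> i y \<noteq> l i"
      define e where "e = \<bar>\<psi> i y - l i\<bar> / 2"
      have e: "0 < e" using \<open>\<psi> i y \<noteq> l i\<close> unfolding e_def by simp
      have "eventually (\<lambda>n. \<bar>\<psi> i (a (r n)) - l i\<bar> < e) F"
        using tendstoD[OF tendsto_mono[OF F(2) lim[of i]] e] by (simp add: dist_real_def)
      then have "frequently (\<lambda>n. \<bar>\<psi> i (a (r n)) - l i\<bar> < e \<and> \<bar>\<psi> i (a (r n)) - \<psi> i y\<bar> < e) F"
        by (intro frequently_eventually_conj y e)
      then obtain n where "\<bar>\<psi> i (a (r n)) - \<psi> i y\<bar> < e" "\<bar>\<psi> i (a (r n)) - l i\<bar> < e"
        using frequently_ex by blast
      then show False unfolding e_def by (simp add: abs_if split: if_splits)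
    qed
    ultimately show ?thesis using y by blast
  qed
  obtain y where y: "y \<in> closure S" "\<And>i. \<psi> i y = l i"
    using cluster[of sequentially] by auto
  have "limitin weak_topology (\<lambda>n. a (r n)) y sequentially"
    unfolding limitin_weak_topology_iff
  proof (intro allI tendstoI, rule ccontr)
    fix \<phi> :: "'a \<Rightarrow>\<^sub>L real" and e :: real
    let ?P = "\<lambda>n. dist (\<phi> (a (r n))) (\<phi> y) < e"
    assume e: "0 < e" and "\<not> eventually ?P sequentially"
    define F where "F = inf sequentially (principal {n. \<not> ?P n})"
    have "F \<noteq> bot"
      using \<open>\<not> eventually ?P sequentially\<close>
      unfolding F_def trivial_limit_def eventually_inf_principal by simp
    moreover have "F \<le> sequentially" unfolding F_def by simp
    ultimately obtain z where z: "z \<in> closure S" "\<And>i. \<psi> i z = l i"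
      "frequently (\<lambda>n. \<bar>\<phi> (a (r n)) - \<phi> z\<bar> < e) F"
      using cluster[of F] e by blast
    have "z = y" using uniq[OF z(1) y(1)] y(2) z(2) by simp
    then have "frequently ?P F" using z(3) by (simp add: dist_real_def)
    moreover have "eventually (\<lambda>n. \<not> ?P n) F"
      unfolding F_def eventually_inf_principal by simp
    ultimately show False unfolding frequently_def by simp
  qed
  with r show thesis by (rule that)
qed

text \<open>Whitley's argument. Choosing \<open>a n\<close> close to \<open>\<Psi>\<close> on functionals that almost norm
  \<open>\<Psi> - y\<close> for the rational combinations \<open>y\<close> of the earlier terms forces the weak limit of
  every subsequence, which lies in the closed span of the sequence, to represent \<open>\<Psi>\<close>.\<close>

theorem closure_eval_at_if_seq:
  fixes A :: "'a :: real_normed_vector set"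
  assumes A: "bounded A"
    and seq: "\<And>a. (\<And>n. a n \<in> A) \<Longrightarrow>
      \<exists>r x. strict_mono (r :: nat \<Rightarrow> nat) \<and> limitin weak_topology (\<lambda>n. a (r n)) x sequentially"
    and \<Psi>: "\<Psi> \<in> closure (eval_at ` A)"
  shows "\<exists>x. \<Psi> = eval_at x"
proof -
  obtain M where M: "\<And>a. a \<in> A \<Longrightarrow> norm a \<le> M"
    using A unfolding bounded_iff by blast
  note approx = closure_eval_at_approx[OF \<Psi>]
  have \<Psi>_bound: "\<bar>\<Psi> \<phi>\<bar> \<le> M" if \<phi>: "norm \<phi> \<le> 1" for \<phi>
  proof (rule field_le_epsilon)
    fix e :: real assume "0 < e"
    then obtain a where a: "a \<in> A" "\<bar>blinfun_apply \<phi> a - \<Psi> \<phi>\<bar> < e"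
      using approx[of "{\<phi>}" e] by auto
    have "\<bar>blinfun_apply \<phi> a\<bar> \<le> norm a"
      using norm_blinfun[of \<phi> a] mult_right_mono[OF \<phi>, of "norm a"] by simp
    then show "\<bar>\<Psi> \<phi>\<bar> \<le> M + e" using a M[OF a(1)] by simp
  qed
  have \<Psi>_scale: "\<Psi> (c *\<^sub>R \<phi>) = c * \<Psi> \<phi>" for c \<phi>
  proof (rule ccontr)
    assume ne: "\<Psi> (c *\<^sub>R \<phi>) \<noteq> c * \<Psi> \<phi>"
    define d where "d = \<bar>\<Psi> (c *\<^sub>R \<phi>) - c * \<Psi> \<phi>\<bar>"
    have d: "0 < d" using ne unfolding d_def by simp
    \<comment> \<open>The approximation errors at \<open>c \<phi>\<close> and at
      \<open>\<phi>\<close> add up to less than \<open>e + |c| * e\<close>, which is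
      \<open>d\<close>.\<close>
    define e where "e = d / (1 + \<bar>c\<bar>)"
    have "0 < e" using d unfolding e_def by (intro divide_pos_pos) auto
    then obtain a where a: "\<bar>blinfun_apply (c *\<^sub>R \<phi>) a - \<Psi> (c *\<^sub>R \<phi>)\<bar> < e" "\<bar>blinfun_apply \<phi> a - \<Psi> \<phi>\<bar> < e"
      using approx[of "{\<phi>, c *\<^sub>R \<phi>}" e] by auto
    have "d = \<bar>(\<Psi> (c *\<^sub>R \<phi>) - blinfun_apply (c *\<^sub>R \<phi>) a) + c * (blinfun_apply \<phi> a - \<Psi> \<phi>)\<bar>"
      unfolding d_def by (simp add: blinfun.scaleR_left algebra_simps)
    also have "\<dots> \<le> \<bar>blinfun_apply (c *\<^sub>R \<phi>) a - \<Psi> (c *\<^sub>R \<phi>)\<bar> + \<bar>c\<bar> * \<bar>blinfun_apply \<phi> a - \<Psi> \<phi>\<bar>"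
      by (rule order_trans[OF abs_triangle_ineq]) (simp add: abs_mult)
    also have "\<dots> < e + \<bar>c\<bar> * e"
      using a by (intro add_less_le_mono mult_left_mono) auto
    also have "\<dots> = e * (1 + \<bar>c\<bar>)" by (simp add: algebra_simps)
    also have "\<dots> = d" unfolding e_def by (simp add: add_nonneg_eq_0_iff)
    finally show False by simp
  qed
  \<comment> \<open>The supremum over the unit ball may not be attained, so \<open>\<psi>\<close> is
    asked for half of it. If no functional reached half, the supremum would be positive and yet at
    most half of itself.\<close>
  have "\<exists>\<psi>. norm \<psi> \<le> 1 \<and> (\<forall>\<phi>. norm \<phi> \<le> 1 \<longrightarrow> \<bar>\<Psi> \<phi> - blinfun_apply \<phi> y\<bar> \<le> 2 * \<bar>\<Psi> \<psi> - blinfun_apply \<psi> y\<bar>)" for y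
  proof (rule ccontr)
    let ?N = "\<lambda>\<phi>. \<bar>\<Psi> \<phi> - blinfun_apply \<phi> y\<bar>"
    assume "\<not> ?thesis"
    then have no: "\<And>\<psi>. norm \<psi> \<le> 1 \<Longrightarrow> \<exists>\<phi>. norm \<phi> \<le> 1 \<and> 2 * ?N \<psi> < ?N \<phi>"
      by (meson not_le)
    define s where "s = (SUP \<phi>\<in>cball 0 1. ?N \<phi>)"
    have "?N \<phi> \<le> M + norm y" if "norm \<phi> \<le> 1" for \<phi>
      using \<Psi>_bound[OF that] norm_blinfun[of \<phi> y] mult_right_mono[OF that, of "norm y"] by simp
    then have bdd: "bdd_above (?N ` cball 0 1)"
      by (intro bdd_aboveI[of _ "M + norm y"]) auto
    have le: "?N \<phi> \<le> s" if "norm \<phi> \<le> 1" for \<phi>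
      unfolding s_def using that by (intro cSUP_upper bdd) auto
    have "0 < s"
      using no[of 0] le by force
    moreover have "s \<le> s / 2"
      unfolding s_def
    proof (rule cSUP_least)
      fix \<phi> :: "'a \<Rightarrow>\<^sub>L real" assume "\<phi> \<in> cball 0 1"
      then obtain \<phi>' where "norm \<phi>' \<le> 1" "2 * ?N \<phi> < ?N \<phi>'" using no[of \<phi>] by auto
      then show "?N \<phi> \<le> (SUP \<phi>\<in>cball 0 1. ?N \<phi>) / 2"
        using le[of \<phi>'] unfolding s_def by simp
    qed auto
    ultimately show False by simp
  qed
  then obtain \<psi> where \<psi>: "\<And>y. norm (\<psi> y) \<le> 1"
    "\<And>y \<phi>. norm \<phi> \<le> 1 \<Longrightarrow> \<bar>\<Psi> \<phi> - blinfun_apply \<phi> y\<bar> \<le> 2 * \<bar>\<Psi> (\<psi> y) - blinfun_apply (\<psi> y) y\<bar>"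
    by metis
  \<comment> \<open>The bound on the length makes the condition at stage \<open>n\<close> depend
    only on the terms of \<open>a\<close> before \<open>n\<close>, as dependent choice requires. A
    fixed coefficient list meets both bounds from some stage on, and the tolerance tends to
    0.\<close>
  define Q where "Q a n b \<longleftrightarrow> b \<in> A \<and> (\<forall>i<n. length (from_nat i :: rat list) \<le> n \<longrightarrow>
     \<bar>blinfun_apply (\<psi> (rat_comb a (from_nat i))) b - \<Psi> (\<psi> (rat_comb a (from_nat i)))\<bar> < 1 / real (Suc n))"
    for a n b
  have "\<exists>a. \<forall>n. Q a n (a n)"
  proof (rule dependent_wellorder_choice)
    fix b and a c :: "nat \<Rightarrow> 'a" and n :: nat
    assume "\<And>m. m < n \<Longrightarrow> a m = c m"
    then have "rat_comb a l = rat_comb c l" if "length l \<le> n" for l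
      using that by (intro rat_comb_cong) simp
    then show "Q a n b = Q c n b"
      unfolding Q_def by (metis (no_types, lifting))
  next
    fix n and a :: "nat \<Rightarrow> 'a"
    show "\<exists>b. Q a n b"
      using approx[of "(\<lambda>i. \<psi> (rat_comb a (from_nat i))) ` {..<n}" "1 / real (Suc n)"]
      unfolding Q_def by auto
  qed
  then obtain a where Q: "\<And>n. Q a n (a n)" by blast
  obtain r x where r: "strict_mono r" and lim: "limitin weak_topology (\<lambda>n. a (r n)) x sequentially"
    using seq[of a] Q unfolding Q_def by blast
  have lim: "(\<lambda>n. blinfun_apply \<phi> (a (r n))) \<longlonglongrightarrow> blinfun_apply \<phi> x" for \<phi> :: "'a \<Rightarrow>\<^sub>L real"
    using lim unfolding limitin_weak_topology_iff by blast
  have x: "x \<in> closure (span (range a))"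
  proof -
    obtain \<phi> :: "'a \<Rightarrow>\<^sub>L real" where \<phi>: "\<And>s. s \<in> span (range a) \<Longrightarrow> \<phi> s = 0"
      "\<phi> x = infdist x (span (range a))"
      by (rule subspace_separation[of "span (range a)" x]) auto
    have "\<phi> (a (r n)) = 0" for n
      by (intro \<phi>(1) span_base) simp
    then have "infdist x (span (range a)) = 0"
      using lim[of \<phi>] \<phi>(2) by (simp add: LIMSEQ_const_iff)
    moreover have "span (range a) \<noteq> {}" using span_zero by blast
    ultimately show ?thesis by (simp add: in_closure_iff_infdist_zero)
  qed
  have eq: "blinfun_apply (\<psi> (rat_comb a l)) x = \<Psi> (\<psi> (rat_comb a l))" for l
  proof -
    define \<phi> where "\<phi> = \<psi> (rat_comb a l)"
    have "(\<lambda>n. blinfun_apply \<phi> (a n) - \<Psi> \<phi>) \<longlonglongrightarrow> 0"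
    proof (rule Lim_null_comparison[OF _ LIMSEQ_inverse_real_of_nat])
      show "eventually (\<lambda>n. norm (blinfun_apply \<phi> (a n) - \<Psi> \<phi>) \<le> inverse (real (Suc n))) sequentially"
        using eventually_gt_at_top[of "to_nat l"] eventually_ge_at_top[of "length l"]
      proof eventually_elim
        case (elim n)
        then show ?case
          using Q[of n] unfolding Q_def \<phi>_def
          by (auto dest!: spec[of _ "to_nat l"] simp: inverse_eq_divide)
      qed
    qed
    then have "(\<lambda>n. blinfun_apply \<phi> (a (r n)) - \<Psi> \<phi>) \<longlonglongrightarrow> 0"
      using LIMSEQ_subseq_LIMSEQ[OF _ r] by (auto simp: o_def)
    moreover have "(\<lambda>n. blinfun_apply \<phi> (a (r n)) - \<Psi> \<phi>) \<longlonglongrightarrow> blinfun_apply \<phi> x - \<Psi> \<phi>"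
      by (intro tendsto_intros lim)
    ultimately have "blinfun_apply \<phi> x - \<Psi> \<phi> = 0"
      using LIMSEQ_unique by blast
    then show ?thesis unfolding \<phi>_def by simp
  qed
  have unit: "\<Psi> \<phi> = blinfun_apply \<phi> x" if \<phi>: "norm \<phi> \<le> 1" for \<phi>
  proof -
    have "\<bar>\<Psi> \<phi> - blinfun_apply \<phi> x\<bar> \<le> 0"
    proof (rule field_le_epsilon)
      fix e :: real assume "0 < e"
      \<comment> \<open>Replacing \<open>x\<close> by the combination costs one third directly. The
        factor 2 in the choice of \<open>\<psi>\<close> costs two thirds, since
        \<open>\<Psi>\<close> and the evaluation at \<open>x\<close> agree on \<open>\<psi>\<close>
        of each combination.\<close>
      then have "0 < e / 3" by simp
      then obtain l where l: "norm (x - rat_comb a l) < e / 3"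
        using rat_comb_dense[OF x] by blast
      let ?y = "rat_comb a l"
      have small: "\<bar>blinfun_apply \<eta> (x - ?y)\<bar> < e / 3" if "norm \<eta> \<le> 1" for \<eta>
        using norm_blinfun[of \<eta> "x - ?y"] mult_right_mono[OF that, of "norm (x - ?y)"] l by simp
      have "\<bar>\<Psi> \<phi> - blinfun_apply \<phi> x\<bar> \<le> \<bar>\<Psi> \<phi> - blinfun_apply \<phi> ?y\<bar> + \<bar>blinfun_apply \<phi> (x - ?y)\<bar>"
        by (simp add: blinfun.diff_right)
      also have "\<dots> \<le> 2 * \<bar>\<Psi> (\<psi> ?y) - blinfun_apply (\<psi> ?y) ?y\<bar> + e / 3"
        using \<psi>(2)[OF \<phi>, of ?y] small[OF \<phi>] by simp
      also have "\<Psi> (\<psi> ?y) - blinfun_apply (\<psi> ?y) ?y = blinfun_apply (\<psi> ?y) (x - ?y)"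
        using eq[of l] by (simp add: blinfun.diff_right)
      finally show "\<bar>\<Psi> \<phi> - blinfun_apply \<phi> x\<bar> \<le> 0 + e"
        using small[OF \<psi>(1)[of ?y]] by simp
    qed
    then show ?thesis by simp
  qed
  have "\<Psi> \<phi> = blinfun_apply \<phi> x" for \<phi>
  proof (cases "\<phi> = 0")
    case True
    then show ?thesis using unit[of 0] by simp
  next
    case False
    then have "\<phi> = norm \<phi> *\<^sub>R (inverse (norm \<phi>) *\<^sub>R \<phi>)" by simp
    then have "\<Psi> \<phi> = norm \<phi> * blinfun_apply (inverse (norm \<phi>) *\<^sub>R \<phi>) x"
      using \<Psi>_scale unit[of "inverse (norm \<phi>) *\<^sub>R \<phi>"] False by (metis norm_sgn order_refl sgn_div_norm)
    then show ?thesis using False by (simp add: blinfun.scaleR_left)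
  qed
  then show ?thesis by blast
qed


section \<open>Functionals on Banach lattices\<close>

lemma norm_abs [simp]: "norm \<bar>x :: 'a :: banach_lattice\<bar> = norm x"
  by (intro antisym norm_le_norm_if_abs_le) simp_all

lemma norm_mono_nonneg: "0 \<le> x \<Longrightarrow> x \<le> y \<Longrightarrow> norm x \<le> norm (y :: 'a :: banach_lattice)"
  by (intro norm_le_norm_if_abs_le) simp

lemma pprt_le_abs: "pprt x \<le> \<bar>x :: 'a :: lattice_ab_group_add_abs\<bar>"
  unfolding pprt_def by (intro sup_least abs_ge_self abs_ge_zero)

lemma inf_add_le:
  fixes x y w :: "'a :: lattice_ab_group_add"
  assumes "0 \<le> x" "0 \<le> y" "0 \<le> w"
  shows "inf w (x + y) \<le> inf w x + inf w y"
proof -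
  let ?z = "inf w (x + y)"
  have z: "?z \<le> w" "?z \<le> x + y" by simp_all
  have "?z - inf w x = sup (?z - w) (?z - x)"
    by (simp add: diff_inf_eq_sup add_sup_distrib_left)
  also have "\<dots> \<le> inf w y"
    using assms z
    by (intro sup_least inf_greatest) (auto simp: diff_le_eq add.commute intro: order_trans add_increasing)
  finally show ?thesis unfolding diff_le_eq by (simp only: add.commute)
qed

lemma inf_sum_le:
  fixes g :: "'i \<Rightarrow> 'a :: lattice_ab_group_add"
  assumes "finite A" "\<And>k. k \<in> A \<Longrightarrow> 0 \<le> g k" "0 \<le> w"
  shows "inf w (sum g A) \<le> (\<Sum>k\<in>A. inf w (g k))"
  using assms(1,2)
proof (induction A rule: finite_induct)
  case empty
  then show ?case by simp
next
  case (insert k A)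
  have "inf w (g k + sum g A) \<le> inf w (g k) + inf w (sum g A)"
    using insert assms(3) by (intro inf_add_le sum_nonneg) auto
  also have "\<dots> \<le> inf w (g k) + (\<Sum>k\<in>A. inf w (g k))"
    using insert by (intro add_left_mono) auto
  finally show ?case using insert by simp
qed

lemma inf_pprt_neg: "inf (pprt (a :: 'a :: lattice_ab_group_add)) (pprt (- a)) = 0"
proof -
  have eq: "pprt (- a) = pprt a + - a"
    using prts[of a] by (simp add: pprt_neg algebra_simps)
  have "inf (pprt a) (pprt a + - a) = pprt a + inf 0 (- a)"
    by (simp add: add_inf_distrib_left)
  also have "inf 0 (- a) = - pprt a"
    by (simp add: pprt_def neg_sup_eq_inf inf.commute)
  finally show ?thesis using eq by simp
qed

text \<open>The positive parts of \<open>x - u\<close> and \<open>u - x\<close> are disjoint, and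
  disjointness survives multiples. As \<open>u\<close> is at most \<open>x\<close> plus the second
  part, only \<open>x\<close> can contribute to the meet. Passing to a natural factor makes the
  multiple a finite sum.\<close>

lemma inf_scaleR_pprt_diff_le:
  fixes x u :: "'a :: banach_lattice"
  assumes "0 \<le> x"
  shows "inf u (c *\<^sub>R pprt (x - u)) \<le> x"
proof -
  define v where "v = pprt (x - u)"
  define w where "w = pprt (u - x)"
  have vw: "0 \<le> v" "0 \<le> w" "inf w v = 0"
    using inf_pprt_neg[of "u - x"] unfolding v_def w_def by simp_all
  obtain n :: nat where n: "c \<le> real n" using real_arch_simple by blast
  have cv: "c *\<^sub>R v \<le> real n *\<^sub>R v"
    using n vw by (intro scaleR_right_mono)
  have nv: "0 \<le> real n *\<^sub>R v" using vw by (intro scaleR_nonneg_nonneg) auto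
  have "real n *\<^sub>R v = (\<Sum>k<n. v)" by (simp add: sum_constant_scaleR)
  moreover have "inf w (\<Sum>k<n. v) \<le> (\<Sum>k<n. inf w v)"
    using vw by (intro inf_sum_le) auto
  ultimately have wv: "inf w (real n *\<^sub>R v) \<le> 0" using vw(3) by simp
  have "u - x \<le> w" unfolding w_def pprt_def by simp
  then have "inf u (c *\<^sub>R v) \<le> inf (real n *\<^sub>R v) (x + w)"
    using cv by (intro inf_greatest) (auto simp: diff_le_eq add.commute intro: le_infI1 le_infI2)
  also have "\<dots> \<le> inf (real n *\<^sub>R v) x + inf (real n *\<^sub>R v) w"
    using assms vw nv by (intro inf_add_le)
  also have "\<dots> \<le> x + 0"
    using wv by (intro add_mono) (simp_all add: inf.commute)
  finally show ?thesis unfolding v_def by simp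
qed

text \<open>Additivity gives homogeneity for integers. For real \<open>c\<close>, the defect
  \<open>h (c x) - c h x\<close> times \<open>n\<close> equals the defect for the fractional part of
  \<open>n c\<close>, which is bounded independently of \<open>n\<close>; so the defect is
  0.\<close>

lemma additive_bounded_linear:
  fixes h :: "'a :: real_normed_vector \<Rightarrow> real"
  assumes add: "\<And>x y. h (x + y) = h x + h y" and bd: "\<And>x. \<bar>h x\<bar> \<le> K * norm x"
  shows "bounded_linear h"
proof -
  have h0: "h 0 = 0" using add[of 0 0] by simp
  have neg: "h (- x) = - h x" for x using add[of x "- x"] h0 by simp
  have nat: "h (real n *\<^sub>R x) = real n * h x" for n x
    by (induction n) (simp_all add: h0 add algebra_simps)
  have int: "h (of_int k *\<^sub>R x) = of_int k * h x" for k x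
  proof (cases "0 \<le> k")
    case True
    then show ?thesis using nat[of "nat k" x] by simp
  next
    case False
    then show ?thesis using nat[of "nat (- k)" x] neg[of "real (nat (- k)) *\<^sub>R x"] by simp
  qed
  have "h (c *\<^sub>R x) = c * h x" for c x
  proof (rule ccontr)
    assume "h (c *\<^sub>R x) \<noteq> c * h x"
    then have "0 < \<bar>h (c *\<^sub>R x) - c * h x\<bar>" by simp
    then obtain n :: nat where n: "\<bar>K\<bar> * norm x + \<bar>h x\<bar> < real n * \<bar>h (c *\<^sub>R x) - c * h x\<bar>"
      using reals_Archimedean3 by blast
    define t where "t = real n * c - of_int \<lfloor>real n * c\<rfloor>"
    have t: "0 \<le> t" "t \<le> 1" unfolding t_def by linarith+
    have "h ((real n * c) *\<^sub>R x) = h (of_int \<lfloor>real n * c\<rfloor> *\<^sub>R x + t *\<^sub>R x)"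
      unfolding t_def by (simp flip: scaleR_add_left)
    then have "real n * h (c *\<^sub>R x) = of_int \<lfloor>real n * c\<rfloor> * h x + h (t *\<^sub>R x)"
      using nat[of n "c *\<^sub>R x"] by (simp add: add int)
    then have "real n * (h (c *\<^sub>R x) - c * h x) = h (t *\<^sub>R x) - t * h x"
      unfolding t_def by (simp add: algebra_simps)
    then have "real n * \<bar>h (c *\<^sub>R x) - c * h x\<bar> = \<bar>h (t *\<^sub>R x) - t * h x\<bar>"
      by (metis abs_mult abs_of_nat)
    also have "\<dots> \<le> \<bar>K\<bar> * norm x + \<bar>h x\<bar>"
    proof -
      have "\<bar>h (t *\<^sub>R x)\<bar> \<le> K * norm (t *\<^sub>R x)" by (rule bd)
      also have "\<dots> \<le> \<bar>K\<bar> * (t * norm x)" using t by (simp add: mult_right_mono)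
      also have "\<dots> \<le> \<bar>K\<bar> * (1 * norm x)" using t by (intro mult_left_mono mult_right_mono) auto
      finally have "\<bar>h (t *\<^sub>R x)\<bar> \<le> \<bar>K\<bar> * norm x" by simp
      moreover have "\<bar>t * h x\<bar> \<le> \<bar>h x\<bar>"
        using t mult_right_mono[of t 1 "\<bar>h x\<bar>"] by (simp add: abs_mult)
      ultimately show ?thesis by linarith
    qed
    finally show False using n by simp
  qed
  then show ?thesis
    using add bd by (intro bounded_linear_intro[where K = K]) (auto simp: mult.commute)
qed

text \<open>Kantorovich's extension: the difference \<open>g a - g b\<close> depends only on
  \<open>a - b\<close>, by additivity on the cone. Every functional built below, such as a modulus,
  a component or a coordinate, is obtained from its values on the cone in this way.\<close>

lemma additive_cone_extend:
  fixes g :: "'a :: banach_lattice \<Rightarrow> real"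
  assumes add: "\<And>x y. 0 \<le> x \<Longrightarrow> 0 \<le> y \<Longrightarrow> g (x + y) = g x + g y"
    and nonneg: "\<And>x. 0 \<le> x \<Longrightarrow> 0 \<le> g x"
    and bd: "\<And>x. 0 \<le> x \<Longrightarrow> g x \<le> M * norm x"
  obtains \<phi> :: "'a \<Rightarrow>\<^sub>L real" where "\<And>x. 0 \<le> x \<Longrightarrow> \<phi> x = g x"
proof -
  define h where "h x = g (pprt x) - g (- nprt x)" for x
  have h_diff: "h (a - b) = g a - g b" if "0 \<le> a" "0 \<le> b" for a b
  proof -
    have "pprt (a - b) + b = a + - nprt (a - b)"
      using prts[of "a - b"] by (simp add: algebra_simps)
    then have "g (pprt (a - b) + b) = g (a + - nprt (a - b))" by simp
    then show ?thesis
      using that add[of "pprt (a - b)" b] add[of a "- nprt (a - b)"] unfolding h_def by simp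
  qed
  have "h (x + y) = h x + h y" for x y
  proof -
    have "x + y = (pprt x + nprt x) + (pprt y + nprt y)"
      by (simp flip: prts)
    also have "\<dots> = (pprt x + pprt y) - (- nprt x + - nprt y)"
      by (simp add: algebra_simps)
    finally have "x + y = (pprt x + pprt y) - (- nprt x + - nprt y)" .
    then have "h (x + y) = g (pprt x + pprt y) - g (- nprt x + - nprt y)"
      by (simp only:) (intro h_diff add_nonneg_nonneg, auto)
    then show ?thesis
      using add[of "pprt x" "pprt y"] add[of "- nprt x" "- nprt y"] unfolding h_def by simp
  qed
  moreover have "\<bar>h x\<bar> \<le> \<bar>M\<bar> * norm x" for x
  proof -
    have le: "g (pprt z) \<le> \<bar>M\<bar> * norm z" for z
    proof -
      have "g (pprt z) \<le> M * norm (pprt z)" by (intro bd) simp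
      also have "\<dots> \<le> \<bar>M\<bar> * norm (pprt z)" by (intro mult_right_mono) auto
      also have "\<dots> \<le> \<bar>M\<bar> * norm z"
        using norm_mono_nonneg[OF _ pprt_le_abs, of z] by (intro mult_left_mono) auto
      finally show ?thesis .
    qed
    have "0 \<le> g (pprt x)" "0 \<le> g (- nprt x)" by (auto intro: nonneg)
    then show ?thesis
      using le[of x] le[of "- x"] unfolding h_def by (simp add: pprt_neg)
  qed
  ultimately have "bounded_linear h" by (rule additive_bounded_linear)
  then have app: "blinfun_apply (Blinfun h) = h" by (rule bounded_linear_Blinfun_apply)
  have g0: "g 0 = 0" using add[of 0 0] by simp
  have "Blinfun h x = g x" if "0 \<le> x" for x
    using h_diff[OF that order_refl] g0 by (simp add: app)
  then show thesis by (rule that)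
qed

lemma positive_blinfun_nonneg:
  fixes f :: "'a :: banach_lattice \<Rightarrow>\<^sub>L real"
  shows "0 \<le> f \<Longrightarrow> 0 \<le> x \<Longrightarrow> 0 \<le> f x"
  unfolding less_eq_blinfun_def by simp

lemma positive_blinfun_mono:
  fixes f :: "'a :: banach_lattice \<Rightarrow>\<^sub>L real"
  assumes "0 \<le> f" "x \<le> y"
  shows "f x \<le> f y"
  using positive_blinfun_nonneg[OF assms(1), of "y - x"] assms(2) by (simp add: blinfun.diff_right)

text \<open>This is the part of \<open>f\<close> carried by the ideal that \<open>W\<close>
  generates. Subadditivity comes from \<open>inf_add_le\<close>; for superadditivity,
  \<open>inf x v + inf y w\<close> lies below \<open>inf (x + y) z\<close> as soon as
  \<open>v + w \<le> z\<close>, which explains the form of the directedness assumption.\<close>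

lemma component_functional:
  fixes f :: "'a :: banach_lattice \<Rightarrow>\<^sub>L real"
  assumes f: "0 \<le> f" and W: "W \<noteq> {}" "\<And>w. w \<in> W \<Longrightarrow> 0 \<le> w"
    and dir: "\<And>v w. v \<in> W \<Longrightarrow> w \<in> W \<Longrightarrow> \<exists>z\<in>W. v + w \<le> z"
  obtains \<phi> :: "'a \<Rightarrow>\<^sub>L real" where "\<And>x. 0 \<le> x \<Longrightarrow> \<phi> x = (SUP w\<in>W. f (inf x w))"
proof (rule additive_cone_extend)
  let ?g = "\<lambda>x. SUP w\<in>W. f (inf x w)"
  note mono = positive_blinfun_mono[OF f]
  have bdd: "bdd_above ((\<lambda>w. f (inf x w)) ` W)" for x
    by (intro bdd_aboveI2[of _ _ "f x"] mono) simp
  have up: "f (inf x w) \<le> ?g x" if "w \<in> W" for x w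
    using that by (intro cSUP_upper bdd)
  show "?g (x + y) = ?g x + ?g y" if xy: "0 \<le> x" "0 \<le> y" for x y
  proof (rule antisym)
    show "?g (x + y) \<le> ?g x + ?g y"
    proof (rule cSUP_least[OF W(1)])
      fix w assume w: "w \<in> W"
      have "f (inf (x + y) w) \<le> f (inf x w + inf y w)"
        using inf_add_le[OF xy W(2)[OF w]] by (intro mono) (simp add: inf.commute)
      then show "f (inf (x + y) w) \<le> ?g x + ?g y"
        using up[OF w, of x] up[OF w, of y] by (simp add: blinfun.add_right)
    qed
    have le: "f (inf x v) + f (inf y w) \<le> ?g (x + y)" if vw: "v \<in> W" "w \<in> W" for v w
    proof -
      obtain z where z: "z \<in> W" "v + w \<le> z" using dir[OF vw] by blast
      have "inf x v + inf y w \<le> inf (x + y) z"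
        using z(2) by (intro inf_greatest add_mono order_trans[OF _ z(2)]) auto
      then have "f (inf x v) + f (inf y w) \<le> f (inf (x + y) z)"
        unfolding blinfun.add_right[symmetric] by (rule mono)
      also have "\<dots> \<le> ?g (x + y)" by (rule up[OF z(1)])
      finally show ?thesis .
    qed
    have "?g x \<le> ?g (x + y) - f (inf y w)" if "w \<in> W" for w
      using le that by (intro cSUP_least[OF W(1)]) (simp add: le_diff_eq)
    then have "?g y \<le> ?g (x + y) - ?g x"
      by (intro cSUP_least[OF W(1)]) (simp add: le_diff_eq add.commute)
    then show "?g x + ?g y \<le> ?g (x + y)" by simp
  qed
  show "0 \<le> ?g x" if "0 \<le> x" for x
  proof -
    obtain w where w: "w \<in> W" using W(1) by blast
    have "0 \<le> f (inf x w)"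
      using that W(2)[OF w] by (intro positive_blinfun_nonneg[OF f]) simp
    then show ?thesis using up[OF w, of x] by simp
  qed
  show "?g x \<le> norm f * norm x" if "0 \<le> x" for x
  proof (rule cSUP_least[OF W(1)])
    fix w assume "w \<in> W"
    have "f (inf x w) \<le> f x" by (intro mono) simp
    also have "\<dots> \<le> norm f * norm x" using norm_blinfun[of f x] by simp
    finally show "f (inf x w) \<le> norm f * norm x" .
  qed
qed (rule that)

text \<open>The Riesz-Kantorovich formula for the modulus. Its additivity rests on splitting an
  element of modulus at most \<open>x + y\<close> into two of moduli at most \<open>x\<close> and
  \<open>y\<close>.\<close>

lemma abs_functional:
  fixes f :: "'a :: banach_lattice \<Rightarrow>\<^sub>L real"
  obtains g :: "'a \<Rightarrow>\<^sub>L real" where "0 \<le> g" "\<And>x. \<bar>f x\<bar> \<le> g \<bar>x\<bar>"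
proof -
  let ?g = "\<lambda>x. SUP y\<in>{y. \<bar>y\<bar> \<le> x}. f y"
  have bound: "f y \<le> norm f * norm x" if "\<bar>y\<bar> \<le> x" for x y
  proof -
    have "norm \<bar>y\<bar> \<le> norm x" using that by (intro norm_mono_nonneg) auto
    then show ?thesis
      using norm_blinfun[of f y] mult_left_mono[of "norm y" "norm x" "norm f"] by simp
  qed
  have bdd: "bdd_above ((\<lambda>y. f y) ` {y. \<bar>y\<bar> \<le> x})" for x
    by (intro bdd_aboveI2[of _ _ "norm f * norm x"] bound) simp
  have up: "f y \<le> ?g x" if "\<bar>y\<bar> \<le> x" for x y
    using that by (intro cSUP_upper bdd) simp
  have ne: "{y. \<bar>y\<bar> \<le> x} \<noteq> {}" if "0 \<le> x" for x :: 'a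
    using that by (auto intro!: exI[of _ 0])
  have nonneg: "0 \<le> ?g x" if "0 \<le> x" for x
    using up[of 0 x] that by simp
  obtain g :: "'a \<Rightarrow>\<^sub>L real" where g: "\<And>x. 0 \<le> x \<Longrightarrow> g x = ?g x"
  proof (rule additive_cone_extend)
    show "?g (x + y) = ?g x + ?g y" if xy: "0 \<le> x" "0 \<le> y" for x y
    proof (rule antisym)
      have "0 \<le> x + y" using xy by simp
      then show "?g (x + y) \<le> ?g x + ?g y"
      proof (intro cSUP_least ne)
        fix z assume "z \<in> {z. \<bar>z\<bar> \<le> x + y}"
        then have z: "z \<le> x + y" "- z \<le> x + y"
          by (auto intro: order_trans[OF abs_ge_self] order_trans[OF abs_ge_minus_self])
        \<comment> \<open>\<open>p\<close> is \<open>z\<close> clamped to the order interval from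
          \<open>- x\<close> to \<open>x\<close>; what the clamping removes lies between
          \<open>- y\<close> and \<open>y\<close>.\<close>
        define p where "p = inf (sup z (- x)) x"
        have "p \<le> x" "- x \<le> p"
          using xy unfolding p_def by (auto intro: order_trans[of _ 0])
        then have p: "\<bar>p\<bar> \<le> x" by (intro abs_leI) (auto simp: minus_le_iff)
        have "z - p = sup (z - sup z (- x)) (z - x)"
          unfolding p_def by (simp add: diff_inf_eq_sup add_sup_distrib_left)
        moreover have "z - sup z (- x) = inf 0 (z + x)"
          by (simp add: diff_sup_eq_inf add_inf_distrib_left)
        ultimately have "z - p = sup (inf 0 (z + x)) (z - x)" by simp
        moreover have "inf 0 (z + x) \<le> y" using xy by (intro le_infI1)
        moreover have "z - x \<le> y" using z by (simp add: diff_le_eq add.commute)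
        moreover have "- z + (z - y) \<le> (x + y) + (z - y)"
          using z(2) by (rule add_right_mono)
        then have "- y \<le> inf 0 (z + x)"
          using xy by (simp add: algebra_simps)
        ultimately have "z - p \<le> y" "- y \<le> z - p"
          by (auto intro: le_supI1)
        then have "\<bar>z - p\<bar> \<le> y"
          by (intro abs_leI) (simp_all only: minus_le_iff)
        then have "f p + f (z - p) \<le> ?g x + ?g y"
          by (intro add_mono up p)
        then show "f z \<le> ?g x + ?g y" by (simp add: blinfun.diff_right)
      qed
      have le: "f p + f q \<le> ?g (x + y)" if "\<bar>p\<bar> \<le> x" "\<bar>q\<bar> \<le> y" for p q
        unfolding blinfun.add_right[symmetric]
        using that by (intro up order_trans[OF abs_triangle_ineq] add_mono)
      have "?g x \<le> ?g (x + y) - f q" if "\<bar>q\<bar> \<le> y" for q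
        using le that by (intro cSUP_least[OF ne[OF xy(1)]]) (simp add: le_diff_eq)
      then have "?g y \<le> ?g (x + y) - ?g x"
        by (intro cSUP_least[OF ne[OF xy(2)]]) (simp add: le_diff_eq add.commute)
      then show "?g x + ?g y \<le> ?g (x + y)" by simp
    qed
    show "?g x \<le> norm f * norm x" if "0 \<le> x" for x
      using bound by (intro cSUP_least[OF ne[OF that]]) simp
  qed (use nonneg in auto)
  have "0 \<le> g"
    unfolding less_eq_blinfun_def using g nonneg by simp
  moreover have "\<bar>f x\<bar> \<le> g \<bar>x\<bar>" for x
    using up[of x "\<bar>x\<bar>"] up[of "- x" "\<bar>x\<bar>"] g[of "\<bar>x\<bar>"] by (simp add: blinfun.minus_right)
  ultimately show thesis by (rule that)
qed


section \<open>Order continuous duals\<close>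

lemma sum_half_powers_le: "(\<Sum>k=N..<M. (1/2) ^ k) \<le> 2 * (1/2 :: real) ^ N"
proof (cases "N \<le> M")
  case True
  then have "(\<Sum>k=N..<M. (1/2) ^ k) = 2 * (1/2 :: real) ^ N - 2 * (1/2) ^ M"
    by (induction M rule: dec_induct) auto
  then show ?thesis by simp
qed simp

text \<open>The pointwise limit on the cone is additive and extends to a functional. It is the
  greatest lower bound of the sequence, so order continuity applies to the differences
  \<open>P n - \<phi>\<close>.\<close>

lemma decreasing_functionals_limit:
  fixes P :: "nat \<Rightarrow> 'a :: banach_lattice \<Rightarrow>\<^sub>L real"
  assumes oc: "order_continuous_norm TYPE('a \<Rightarrow>\<^sub>L real)"
    and dec: "decseq P" and nonneg: "\<And>n. 0 \<le> P n"
  obtains \<phi> where "(\<lambda>n. norm (P n - \<phi>)) \<longlonglongrightarrow> 0" "\<And>x. 0 \<le> x \<Longrightarrow> (\<lambda>n. P n x) \<longlonglongrightarrow> \<phi> x"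
proof -
  define g where "g x = lim (\<lambda>n. P n x)" for x
  have mono: "P n x \<le> P m x" if "m \<le> n" "0 \<le> x" for m n x
    using decseqD[OF dec that(1)] that(2) unfolding less_eq_blinfun_def by blast
  have pos: "0 \<le> P n x" if "0 \<le> x" for n x
    using nonneg that by (rule positive_blinfun_nonneg)
  have lim: "(\<lambda>n. P n x) \<longlonglongrightarrow> g x" if x: "0 \<le> x" for x
  proof -
    have "decseq (\<lambda>n. P n x)" using mono x by (intro decseq_SucI) simp
    then show ?thesis
      using decseq_convergent[of "\<lambda>n. P n x" 0] pos[OF x] unfolding g_def
      by (metis limI)
  qed
  have g_le: "g x \<le> P n x" if "0 \<le> x" for n x
    using LIMSEQ_le_const2[OF lim[OF that], of "P n x"] mono[OF _ that] by blast
  obtain \<phi> :: "'a \<Rightarrow>\<^sub>L real" where \<phi>: "\<And>x. 0 \<le> x \<Longrightarrow> \<phi> x = g x"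
  proof (rule additive_cone_extend)
    show "g (x + y) = g x + g y" if "0 \<le> x" "0 \<le> y" for x y
    proof (rule LIMSEQ_unique)
      show "(\<lambda>n. P n (x + y)) \<longlonglongrightarrow> g x + g y"
        unfolding blinfun.add_right using that by (intro tendsto_add lim)
    qed (use that in \<open>intro lim, simp\<close>)
    show "0 \<le> g x" if "0 \<le> x" for x
      using LIMSEQ_le_const[OF lim[OF that], of 0] pos[OF that] by blast
    show "g x \<le> norm (P 0) * norm x" if "0 \<le> x" for x
      using g_le[OF that, of 0] norm_blinfun[of "P 0" x] by simp
  qed (rule that)
  have dir: "directed (UNIV :: nat set) (\<le>)"
    unfolding directed_def by (auto intro: max.cobounded1 max.cobounded2)
  have "((\<lambda>n. norm (P n - \<phi>)) \<longlongrightarrow> 0) (net_filter UNIV (\<le>))"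
  proof (rule order_continuous_norm_net[OF oc dir])
    show "P j - \<phi> \<le> P i - \<phi>" if "i \<le> j" for i j
      using mono[OF that] unfolding less_eq_blinfun_def by (simp add: blinfun.diff_left)
    show "0 \<le> P i - \<phi>" for i
      using g_le \<phi> unfolding less_eq_blinfun_def by (simp add: blinfun.diff_left)
    show "l \<le> 0" if l: "\<And>i. i \<in> UNIV \<Longrightarrow> l \<le> P i - \<phi>" for l
      unfolding less_eq_blinfun_def
    proof (intro allI impI)
      fix x :: 'a assume x: "0 \<le> x"
      have "(\<lambda>n. P n x - \<phi> x) \<longlonglongrightarrow> g x - \<phi> x"
        by (intro tendsto_diff lim x tendsto_const)
      moreover have "l x \<le> P n x - \<phi> x" for n
        using l[of n] x unfolding less_eq_blinfun_def by (simp add: blinfun.diff_left)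
      ultimately show "l x \<le> blinfun_apply 0 x"
        using LIMSEQ_le_const[of _ "g x - \<phi> x" "l x"] \<phi>[OF x] by auto
    qed
  qed
  then have "(\<lambda>n. norm (P n - \<phi>)) \<longlonglongrightarrow> 0"
    unfolding tendsto_iff eventually_net_filter[OF dir] eventually_sequentially by simp
  then show thesis
    using lim \<phi> by (intro that[of \<phi>]) simp_all
qed

text \<open>Otherwise one finds bounded \<open>a n \<ge> 0\<close>, each of size at least \<open>e\<close> on the component of \<open>f\<close>
  carried by the excess \<open>v n\<close> of \<open>a n\<close> over \<open>2\<^sup>n\<close> times the sum of its predecessors. The components
  \<open>P n\<close> carried by the tails of \<open>v\<close> decrease to a functional that vanishes at all \<open>a j\<close>; as the
  dual norm is order continuous, this contradicts \<open>P n (a n) > e\<close>.\<close>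

lemma order_continuous_dual_approx:
  fixes f :: "'a :: banach_lattice \<Rightarrow>\<^sub>L real"
  assumes oc: "order_continuous_norm TYPE('a \<Rightarrow>\<^sub>L real)" and f: "0 \<le> f" and e: "0 < e"
    and R: "0 < R"
  obtains u where "0 \<le> u" "\<And>x. norm x \<le> R \<Longrightarrow> f (pprt (\<bar>x\<bar> - u)) \<le> e"
proof (rule ccontr)
  assume "\<not> thesis"
  with that have no: "\<exists>x. norm x \<le> R \<and> e < f (pprt (\<bar>x\<bar> - u))" if "0 \<le> u" for u
    using \<open>0 \<le> u\<close> by (meson not_le)
  note mono = positive_blinfun_mono[OF f]
  define Q where "Q a n b \<longleftrightarrow> 0 \<le> b \<and> norm b \<le> R \<and> e < f (pprt (b - 2 ^ n *\<^sub>R (\<Sum>k<n. a k)))"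
    for a :: "nat \<Rightarrow> 'a" and n b
  have "\<exists>a. \<forall>n. Q a n (a n)"
  proof (rule dependent_wellorder_choice)
    fix b and a c :: "nat \<Rightarrow> 'a" and n :: nat
    assume "\<And>m. m < n \<Longrightarrow> a m = c m"
    then have "(\<Sum>k<n. a k) = (\<Sum>k<n. c k)" by (intro sum.cong) auto
    then show "Q a n b = Q c n b" unfolding Q_def by simp
  next
    fix n and a :: "nat \<Rightarrow> 'a"
    assume "\<And>m. m < n \<Longrightarrow> Q a m (a m)"
    then have "0 \<le> 2 ^ n *\<^sub>R (\<Sum>k<n. a k)"
      unfolding Q_def by (intro scaleR_nonneg_nonneg sum_nonneg) auto
    then obtain x where "norm x \<le> R" "e < f (pprt (\<bar>x\<bar> - 2 ^ n *\<^sub>R (\<Sum>k<n. a k)))"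
      using no by blast
    then show "\<exists>b. Q a n b" unfolding Q_def by (intro exI[of _ "\<bar>x\<bar>"]) auto
  qed
  then obtain a where a: "\<And>n. Q a n (a n)" by blast
  define u where "u n = 2 ^ n *\<^sub>R (\<Sum>k<n. a k)" for n
  define v where "v n = pprt (a n - u n)" for n
  have a_nonneg: "0 \<le> a n" and a_norm: "norm (a n) \<le> R" and fv: "e < f (v n)" for n
    using a[of n] unfolding Q_def u_def v_def by auto
  have u_nonneg: "0 \<le> u n" for n
    unfolding u_def using a_nonneg by (intro scaleR_nonneg_nonneg sum_nonneg) auto
  have v_nonneg: "0 \<le> v n" and v_le: "v n \<le> a n" for n
    using u_nonneg[of n] a_nonneg[of n] unfolding v_def pprt_def by simp_all
  define s where "s N M = (\<Sum>k=N..<M. v k)" for N M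
  have s_nonneg: "0 \<le> s N M" for N M
    unfolding s_def using v_nonneg by (intro sum_nonneg)
  have s_mono: "s N M \<le> s N' M'" if "N' \<le> N" "M \<le> M'" for N M N' M'
    unfolding s_def using that v_nonneg by (intro sum_mono2) auto
  define W where "W N = {real m *\<^sub>R s N M |m M. True}" for N
  have W_nonneg: "0 \<le> w" if "w \<in> W N" for w N
    using that s_nonneg unfolding W_def by (auto intro: scaleR_nonneg_nonneg)
  have W_ne: "W N \<noteq> {}" for N
    unfolding W_def by blast
  have W_dir: "\<exists>z\<in>W N. x + y \<le> z" if xy: "x \<in> W N" "y \<in> W N" for x y N
  proof -
    obtain m M m' M' where xy: "x = real m *\<^sub>R s N M" "y = real m' *\<^sub>R s N M'"
      using xy unfolding W_def by blast
    have "x + y \<le> real m *\<^sub>R s N (max M M') + real m' *\<^sub>R s N (max M M')"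
      unfolding xy by (intro add_mono scaleR_left_mono s_mono) auto
    also have "\<dots> = real (m + m') *\<^sub>R s N (max M M')"
      by (simp add: scaleR_add_left)
    finally show ?thesis unfolding W_def by blast
  qed
  have "\<exists>\<phi>::'a \<Rightarrow>\<^sub>L real. \<forall>x\<ge>0. \<phi> x = (SUP w\<in>W N. f (inf x w))" for N
    by (rule component_functional[OF f W_ne W_nonneg W_dir]) blast+
  then obtain P :: "nat \<Rightarrow> 'a \<Rightarrow>\<^sub>L real" where
    P: "\<And>N x. 0 \<le> x \<Longrightarrow> P N x = (SUP w\<in>W N. f (inf x w))"
    by metis
  have P_ge: "f (inf x w) \<le> P N x" if "w \<in> W N" "0 \<le> x" for N x w
    unfolding P[OF that(2)] using that(1)
    by (intro cSUP_upper bdd_aboveI2[of _ _ "f x"] mono) auto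
  have P_le: "P N x \<le> b" if "0 \<le> x" "\<And>w. w \<in> W N \<Longrightarrow> f (inf x w) \<le> b" for N x b
    unfolding P[OF that(1)] using that(2) by (intro cSUP_least W_ne)
  have P_nonneg: "0 \<le> P N" for N
    unfolding less_eq_blinfun_def
  proof (intro allI impI)
    fix x :: 'a assume x: "0 \<le> x"
    obtain w where w: "w \<in> W N" using W_ne by blast
    have "0 \<le> f (inf x w)"
      using x W_nonneg[OF w] by (intro positive_blinfun_nonneg[OF f]) simp
    then show "blinfun_apply 0 x \<le> P N x" using P_ge[OF w x] by simp
  qed
  have dec: "decseq P"
  proof (rule monotoneI, unfold less_eq_blinfun_def, intro allI impI)
    fix N' N :: nat and x :: 'a assume N: "N' \<le> N" and x: "0 \<le> x"
    show "P N x \<le> P N' x"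
    proof (rule P_le[OF x])
      fix w assume "w \<in> W N"
      then obtain m M where w: "w = real m *\<^sub>R s N M" unfolding W_def by blast
      have "inf x w \<le> inf x (real m *\<^sub>R s N' M)"
        unfolding w using N by (intro inf_mono scaleR_left_mono s_mono) auto
      then have "f (inf x w) \<le> f (inf x (real m *\<^sub>R s N' M))" by (rule mono)
      also have "\<dots> \<le> P N' x" using x by (intro P_ge) (auto simp: W_def)
      finally show "f (inf x w) \<le> P N' x" .
    qed
  qed
  have big: "e < P N (a N)" for N
  proof -
    have "v N = real 1 *\<^sub>R s N (Suc N)" unfolding s_def by simp
    then have "v N \<in> W N" unfolding W_def by blast
    then have "f (inf (a N) (v N)) \<le> P N (a N)" using a_nonneg by (intro P_ge)
    moreover have "inf (a N) (v N) = v N" using v_le by (simp add: inf.absorb2)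
    ultimately show ?thesis using fv[of N] by simp
  qed
  define B where "B = norm f * R"
  have fa: "f (a k) \<le> B" for k
    using norm_blinfun[of f "a k"] mult_left_mono[OF a_norm[of k] norm_ge_zero[of f]]
    unfolding B_def by simp
  have B: "0 \<le> B" unfolding B_def using R by simp
  \<comment> \<open>Here the factor \<open>2 ^ k\<close> in \<open>u k\<close> pays off. As
    \<open>a j\<close> is a summand of \<open>u k\<close>, the multiple
    \<open>2 ^ k *\<^sub>R ?t\<close> lies below both \<open>u k\<close> and a multiple of
    \<open>v k\<close>, hence below \<open>a k\<close> by \<open>inf_scaleR_pprt_diff_le\<close>.
    Dividing by \<open>2 ^ k\<close> leaves a bound that is summable over the tail.\<close>
  have small: "f (inf (a j) (c *\<^sub>R v k)) \<le> (1/2) ^ k * B" if jk: "j < k" for j k c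
  proof -
    let ?t = "inf (a j) (c *\<^sub>R v k)"
    have "2 ^ k *\<^sub>R ?t \<le> 2 ^ k *\<^sub>R a j" by (intro scaleR_left_mono) auto
    also have "\<dots> \<le> u k"
      unfolding u_def using jk a_nonneg sum_mono2[of "{..<k}" "{j}" a]
      by (intro scaleR_left_mono) auto
    finally have "2 ^ k *\<^sub>R ?t \<le> u k" .
    moreover have "2 ^ k *\<^sub>R ?t \<le> 2 ^ k *\<^sub>R c *\<^sub>R v k" by (intro scaleR_left_mono) auto
    ultimately have "2 ^ k *\<^sub>R ?t \<le> inf (u k) ((2 ^ k * c) *\<^sub>R v k)" by simp
    also have "\<dots> \<le> a k"
      unfolding v_def using a_nonneg by (rule inf_scaleR_pprt_diff_le)
    finally have "f (2 ^ k *\<^sub>R ?t) \<le> f (a k)" by (rule mono)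
    then have "2 ^ k * f ?t \<le> B" using fa[of k] by (simp add: blinfun.scaleR_right)
    then show ?thesis by (simp add: field_simps power_divide)
  qed
  have P_small: "P N (a j) \<le> 2 * (1/2) ^ N * B" if "j < N" for j N
  proof (rule P_le[OF a_nonneg])
    fix w assume "w \<in> W N"
    then obtain m M where "w = real m *\<^sub>R s N M" unfolding W_def by blast
    then have w: "w = (\<Sum>k=N..<M. real m *\<^sub>R v k)"
      unfolding s_def by (simp add: scaleR_sum_right)
    have "f (inf (a j) w) \<le> f (\<Sum>k=N..<M. inf (a j) (real m *\<^sub>R v k))"
      unfolding w using a_nonneg v_nonneg
      by (intro mono inf_sum_le) (auto intro: scaleR_nonneg_nonneg)
    also have "\<dots> = (\<Sum>k=N..<M. f (inf (a j) (real m *\<^sub>R v k)))"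
      by (rule blinfun.sum_right)
    also have "\<dots> \<le> (\<Sum>k=N..<M. (1/2) ^ k * B)"
      using that by (intro sum_mono small) auto
    also have "\<dots> \<le> 2 * (1/2) ^ N * B"
      unfolding sum_distrib_right[symmetric] using B sum_half_powers_le by (intro mult_right_mono)
    finally show "f (inf (a j) w) \<le> 2 * (1/2) ^ N * B" .
  qed
  obtain \<phi> where \<phi>: "(\<lambda>n. norm (P n - \<phi>)) \<longlonglongrightarrow> 0" "\<And>x. 0 \<le> x \<Longrightarrow> (\<lambda>n. P n x) \<longlonglongrightarrow> \<phi> x"
    by (rule decreasing_functionals_limit[OF oc dec P_nonneg]) (rule that)
  have "\<phi> (a j) = 0" for j
  proof -
    have "(\<lambda>N. P N (a j)) \<longlonglongrightarrow> 0"
    proof (rule tendsto_sandwich[OF _ _ tendsto_const])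
      show "eventually (\<lambda>N. 0 \<le> P N (a j)) sequentially"
        using positive_blinfun_nonneg[OF P_nonneg a_nonneg] by simp
      show "eventually (\<lambda>N. P N (a j) \<le> 2 * (1/2) ^ N * B) sequentially"
        using eventually_gt_at_top[of j] by eventually_elim (rule P_small)
      have "(\<lambda>N. 2 * (1/2) ^ N * B) \<longlonglongrightarrow> 2 * 0 * B"
        by (intro tendsto_intros LIMSEQ_realpow_zero) auto
      then show "(\<lambda>N. 2 * (1/2) ^ N * B) \<longlonglongrightarrow> 0" by simp
    qed
    then show ?thesis using \<phi>(2)[OF a_nonneg] LIMSEQ_unique by blast
  qed
  then have "e < norm (P N - \<phi>) * R" for N
  proof -
    have "e < (P N - \<phi>) (a N)"
      using big[of N] \<open>\<And>j. \<phi> (a j) = 0\<close> by (simp add: blinfun.diff_left)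
    also have "\<dots> \<le> norm (P N - \<phi>) * norm (a N)"
      using norm_blinfun[of "P N - \<phi>" "a N"] by simp
    also have "\<dots> \<le> norm (P N - \<phi>) * R" by (intro mult_left_mono a_norm) simp
    finally show ?thesis .
  qed
  moreover have "(\<lambda>N. norm (P N - \<phi>) * R) \<longlonglongrightarrow> 0 * R"
    by (intro tendsto_mult \<phi>(1) tendsto_const)
  ultimately have "e \<le> 0 * R"
    using LIMSEQ_le_const[of "\<lambda>N. norm (P N - \<phi>) * R" "0 * R" e] by (meson less_imp_le)
  then show False using e by simp
qed

text \<open>After passing to a positive functional that dominates \<open>\<phi>\<close>, the modulus
  of the difference splits into its meet with \<open>u\<close>, handled by the convergence, and its
  excess over \<open>u\<close>, which is small uniformly in \<open>i\<close>.\<close>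

theorem uaw_tendsto_imp_weak:
  fixes f :: "'i \<Rightarrow> 'a :: banach_lattice"
  assumes oc: "order_continuous_norm TYPE('a \<Rightarrow>\<^sub>L real)"
    and f: "uaw_tendsto f y F" and bd: "\<And>i. norm (f i) \<le> M"
  shows "limitin weak_topology f y F"
  unfolding limitin_weak_topology_iff
proof (intro allI tendstoI)
  fix \<phi> :: "'a \<Rightarrow>\<^sub>L real" and e :: real assume e: "0 < e"
  obtain g :: "'a \<Rightarrow>\<^sub>L real" where g: "0 \<le> g" "\<And>x. \<bar>\<phi> x\<bar> \<le> g \<bar>x\<bar>"
    by (rule abs_functional[of \<phi>]) (rule that)
  \<comment> \<open>The summand 1 makes the radius of the ball containing all differences positive,
    as \<open>order_continuous_dual_approx\<close> demands.\<close>
  have "0 < \<bar>M\<bar> + norm y + 1" "0 < e / 2"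
    using e by (auto intro: add_nonneg_pos)
  then obtain u where u: "0 \<le> u" "\<And>x. norm x \<le> \<bar>M\<bar> + norm y + 1 \<Longrightarrow> g (pprt (\<bar>x\<bar> - u)) \<le> e / 2"
    using order_continuous_dual_approx[OF oc g(1)] by metis
  have "((\<lambda>i. g (inf \<bar>f i - y\<bar> u)) \<longlongrightarrow> 0) F"
    using f u(1) unfolding uaw_tendsto_def limitin_weak_topology_iff by (simp add: blinfun.zero_right)
  then have "eventually (\<lambda>i. g (inf \<bar>f i - y\<bar> u) < e / 2) F"
    using e by (intro order_tendstoD) auto
  then show "eventually (\<lambda>i. dist (\<phi> (f i)) (\<phi> y) < e) F"
  proof eventually_elim
    case (elim i)
    let ?z = "\<bar>f i - y\<bar>"
    have eq: "pprt (?z - u) = ?z - inf ?z u"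
      by (simp add: pprt_def diff_inf_eq_sup add_sup_distrib_left sup.commute)
    have "g ?z = g (inf ?z u) + g (pprt (?z - u))"
      unfolding eq blinfun.diff_right by simp
    moreover have "norm (f i - y) \<le> \<bar>M\<bar> + norm y + 1"
      using norm_triangle_ineq4[of "f i" y] bd[of i] by simp
    then have "g (pprt (?z - u)) \<le> e / 2" by (rule u(2))
    ultimately have "\<bar>\<phi> (f i - y)\<bar> < e" using elim g(2)[of "f i - y"] by simp
    then show ?case by (simp add: dist_real_def blinfun.diff_right)
  qed
qed


section \<open>Discrete Banach lattices\<close>

text \<open>Every order ideal containing \<open>a\<close> contains \<open>t a\<close> and then also
  \<open>z\<close>, so \<open>z\<close> lies in the generated ideal, which for an atom is a
  line.\<close>

lemma atom_interval:
  assumes a: "atom a" and z: "0 \<le> z" "z \<le> t *\<^sub>R a"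
  shows "\<exists>s\<ge>0. z = s *\<^sub>R a"
proof -
  have pos: "0 < a" and hull: "order_ideal hull {a} = span {a}"
    using a unfolding atom_def by auto
  have "z \<in> I" if I: "order_ideal I" "{a} \<subseteq> I" for I
  proof -
    have "t *\<^sub>R a \<in> I"
      using I unfolding order_ideal_def by (auto intro: subspace_scale)
    moreover have "\<bar>z\<bar> \<le> \<bar>t *\<^sub>R a\<bar>"
      using z by (auto intro: order_trans[OF _ abs_ge_self])
    ultimately show ?thesis using I(1) unfolding order_ideal_def by blast
  qed
  then have "z \<in> order_ideal hull {a}" unfolding hull_def by blast
  then obtain s where s: "z = s *\<^sub>R a"
    unfolding hull span_singleton by blast
  show ?thesis
  proof (cases "0 \<le> s")
    case True
    then show ?thesis using s by blast
  next
    case False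
    then have "z \<le> 0" using s pos by (simp add: scaleR_nonpos_nonneg)
    then have "z = 0" using z(1) by (rule antisym)
    then show ?thesis by (intro exI[of _ 0]) simp
  qed
qed

text \<open>The coordinate of \<open>x \<ge> 0\<close> along \<open>a\<close> is the largest
  multiple of \<open>a\<close> below \<open>x\<close>. It is additive because the meets of
  \<open>t a\<close> with the two summands are again multiples of \<open>a\<close>.\<close>

lemma atom_functional:
  fixes a :: "'a :: banach_lattice"
  assumes a: "atom a"
  obtains \<phi> :: "'a \<Rightarrow>\<^sub>L real" where "\<And>x t. 0 \<le> t \<Longrightarrow> t *\<^sub>R a \<le> \<bar>x\<bar> \<Longrightarrow> t \<le> \<bar>\<phi> x\<bar>"
proof -
  have pos: "0 < a" using a unfolding atom_def by blast
  then have na: "0 < norm a" by auto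
  have a0: "0 \<le> a" using pos by simp
  define g where "g x = (SUP t\<in>{t. 0 \<le> t \<and> t *\<^sub>R a \<le> x}. t)" for x
  have bound: "t \<le> inverse (norm a) * norm x" if t: "0 \<le> t" "t *\<^sub>R a \<le> x" for t x
  proof -
    have "norm (t *\<^sub>R a) \<le> norm x"
      using t a0 by (intro norm_mono_nonneg scaleR_nonneg_nonneg)
    then show ?thesis using t na by (simp add: field_simps)
  qed
  have up: "t \<le> g x" if "0 \<le> t" "t *\<^sub>R a \<le> x" for t x
    unfolding g_def using that bound
    by (intro cSUP_upper bdd_aboveI2[of _ _ "inverse (norm a) * norm x"]) auto
  have least: "g x \<le> b" if "0 \<le> x" "\<And>t. 0 \<le> t \<Longrightarrow> t *\<^sub>R a \<le> x \<Longrightarrow> t \<le> b" for x b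
    unfolding g_def using that by (intro cSUP_least) (auto intro!: exI[of _ 0])
  have nonneg: "0 \<le> g x" if "0 \<le> x" for x
    using that by (intro up) simp_all
  have add: "g (x + y) = g x + g y" if xy: "0 \<le> x" "0 \<le> y" for x y
  proof (rule antisym)
    show "g (x + y) \<le> g x + g y"
    proof (rule least)
      show "0 \<le> x + y" using xy by simp
      fix t :: real assume t: "0 \<le> t" "t *\<^sub>R a \<le> x + y"
      have ta: "0 \<le> t *\<^sub>R a" using t(1) a0 by (rule scaleR_nonneg_nonneg)
      obtain r where r: "0 \<le> r" "inf (t *\<^sub>R a) x = r *\<^sub>R a"
        using ta xy atom_interval[OF a, of "inf (t *\<^sub>R a) x" t] by auto
      obtain s where s: "0 \<le> s" "inf (t *\<^sub>R a) y = s *\<^sub>R a"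
        using ta xy atom_interval[OF a, of "inf (t *\<^sub>R a) y" t] by auto
      have "t *\<^sub>R a = inf (t *\<^sub>R a) (x + y)" using t by (simp add: inf.absorb1)
      also have "\<dots> \<le> r *\<^sub>R a + s *\<^sub>R a"
        unfolding r(2)[symmetric] s(2)[symmetric] using xy ta by (rule inf_add_le)
      finally have "t *\<^sub>R a \<le> (r + s) *\<^sub>R a" by (simp add: scaleR_add_left)
      then have "norm (t *\<^sub>R a) \<le> norm ((r + s) *\<^sub>R a)" by (rule norm_mono_nonneg[OF ta])
      then have "t \<le> r + s" using na t r s by simp
      also have "\<dots> \<le> g x + g y"
        by (intro add_mono up r(1) s(1)) (simp_all flip: r(2) s(2))
      finally show "t \<le> g x + g y" .
    qed
    have le: "r + s \<le> g (x + y)" if "0 \<le> r" "r *\<^sub>R a \<le> x" "0 \<le> s" "s *\<^sub>R a \<le> y" for r s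
      using that by (intro up) (auto simp: scaleR_add_left intro: add_mono)
    have "g x \<le> g (x + y) - s" if "0 \<le> s" "s *\<^sub>R a \<le> y" for s
      using le that by (intro least[OF xy(1)]) (simp add: le_diff_eq)
    then have "g y \<le> g (x + y) - g x"
      by (intro least[OF xy(2)]) (simp add: le_diff_eq add.commute)
    then show "g x + g y \<le> g (x + y)" by simp
  qed
  obtain \<phi> :: "'a \<Rightarrow>\<^sub>L real" where \<phi>: "\<And>x. 0 \<le> x \<Longrightarrow> \<phi> x = g x"
    by (rule additive_cone_extend[of g "inverse (norm a)"])
      (use add nonneg bound in \<open>auto intro: least that\<close>)
  have "t \<le> \<bar>\<phi> x\<bar>" if t: "0 \<le> t" "t *\<^sub>R a \<le> \<bar>x\<bar>" for x t
  proof -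
    let ?p = "pprt x" and ?n = "pprt (- x)"
    \<comment> \<open>Otherwise a positive multiple of the atom would lie below both parts of
      \<open>x\<close>, which are disjoint. With one of the two coordinates equal to 0, the absolute
      value of their difference equals their sum, the coordinate of the modulus.\<close>
    have "g ?p \<le> 0 \<or> g ?n \<le> 0"
    proof (rule ccontr)
      assume no: "\<not> ?thesis"
      have "\<exists>r. 0 < r \<and> r *\<^sub>R a \<le> ?p"
        using no least[of ?p 0] by (metis not_le zero_le_pprt)
      moreover have "\<exists>s. 0 < s \<and> s *\<^sub>R a \<le> ?n"
        using no least[of ?n 0] by (metis not_le zero_le_pprt)
      ultimately obtain r s where rs: "0 < r" "r *\<^sub>R a \<le> ?p" "0 < s" "s *\<^sub>R a \<le> ?n" by blast
      have "min r s *\<^sub>R a \<le> r *\<^sub>R a" "min r s *\<^sub>R a \<le> s *\<^sub>R a"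
        using a0 by (intro scaleR_right_mono; simp)+
      then have "min r s *\<^sub>R a \<le> inf ?p ?n"
        using rs by (auto intro: order_trans)
      then have "norm (min r s *\<^sub>R a) \<le> norm (0 :: 'a)"
        unfolding inf_pprt_neg using rs a0
        by (intro norm_mono_nonneg scaleR_nonneg_nonneg) auto
      then show False using mult_pos_pos[OF rs(1) na] mult_pos_pos[OF rs(3) na] rs
        by (auto simp: min_def split: if_splits)
    qed
    moreover have "0 \<le> g ?p" "0 \<le> g ?n" by (auto intro: nonneg)
    moreover have "\<phi> x = g ?p - g ?n"
    proof -
      have "x = ?p - ?n" using prts[of x] by (simp add: pprt_neg)
      then have "\<phi> x = \<phi> (?p - ?n)" by simp
      then show ?thesis using \<phi>[of ?p] \<phi>[of ?n] by (simp add: blinfun.diff_right)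
    qed
    moreover have "g \<bar>x\<bar> = g ?p + g ?n"
      using add[of ?p ?n] by (simp add: abs_prts pprt_neg)
    moreover have "t \<le> g \<bar>x\<bar>" using t by (rule up)
    ultimately show ?thesis by linarith
  qed
  then show thesis by (rule that)
qed

text \<open>The candidates \<open>z\<close> form an upward directed set \<open>Z\<close>. A lower
  bound of all \<open>u - z\<close> with nonzero positive part would dominate an atom that can be
  added to every member of \<open>Z\<close> without leaving it; then all its natural multiples would
  lie below \<open>u\<close>, which the norm forbids. So \<open>u - z\<close> decreases to 0, and
  order continuity gives the norm estimate.\<close>

lemma discrete_approx:
  fixes u :: "'a :: banach_lattice"
  assumes disc: "discrete_lattice TYPE('a)" and oc: "order_continuous_norm TYPE('a)"
    and u: "0 \<le> u" and e: "0 < e"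
  shows "\<exists>F c z. finite F \<and> (\<forall>a\<in>F. atom a) \<and> 0 \<le> c \<and> 0 \<le> z \<and> z \<le> u \<and>
    z \<le> c *\<^sub>R (\<Sum>a\<in>F. a) \<and> norm (u - z) < e"
proof -
  define Z where "Z = {z. 0 \<le> z \<and> z \<le> u \<and>
    (\<exists>F c. finite F \<and> (\<forall>a\<in>F. atom a) \<and> 0 \<le> c \<and> z \<le> c *\<^sub>R (\<Sum>a\<in>F. a))}"
  have sum_mono_atoms: "c *\<^sub>R (\<Sum>a\<in>F. a) \<le> d *\<^sub>R (\<Sum>a\<in>G. a)"
    if "finite G" "\<forall>a\<in>G. atom a" "F \<subseteq> G" "0 \<le> c" "c \<le> d" for F G :: "'a set" and c d
  proof -
    have pos: "0 \<le> a" if "a \<in> G" for a using \<open>\<forall>a\<in>G. atom a\<close> that unfolding atom_def by auto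
    then have "(\<Sum>a\<in>F. a) \<le> (\<Sum>a\<in>G. a)" using that by (intro sum_mono2) auto
    moreover have "0 \<le> (\<Sum>a\<in>F. a)" using pos that by (intro sum_nonneg) auto
    ultimately show ?thesis using that by (intro scaleR_mono) auto
  qed
  have Z0: "0 \<in> Z"
    unfolding Z_def using u by (auto intro!: exI[of _ "{}"])
  have Z_sup: "sup z w \<in> Z" if zw: "z \<in> Z" "w \<in> Z" for z w
  proof -
    obtain F c G d where F: "finite F" "\<forall>a\<in>F. atom a" "0 \<le> c" "z \<le> c *\<^sub>R (\<Sum>a\<in>F. a)"
      and G: "finite G" "\<forall>a\<in>G. atom a" "0 \<le> d" "w \<le> d *\<^sub>R (\<Sum>a\<in>G. a)"
      using zw unfolding Z_def by blast
    have "z \<le> (c + d) *\<^sub>R (\<Sum>a\<in>F \<union> G. a)"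
      using F G by (intro order_trans[OF F(4)] sum_mono_atoms) auto
    moreover have "w \<le> (c + d) *\<^sub>R (\<Sum>a\<in>F \<union> G. a)"
      using F G by (intro order_trans[OF G(4)] sum_mono_atoms) auto
    moreover have "finite (F \<union> G)" "\<forall>a\<in>F \<union> G. atom a" "0 \<le> c + d" using F G by auto
    ultimately have "\<exists>F c. finite F \<and> (\<forall>a\<in>F. atom a) \<and> 0 \<le> c \<and> sup z w \<le> c *\<^sub>R (\<Sum>a\<in>F. a)"
      by (intro exI[of _ "F \<union> G"] exI[of _ "c + d"]) simp
    then show ?thesis
      using zw unfolding Z_def by (auto intro: le_supI1)
  qed
  have dir: "directed Z (\<le>)"
    unfolding directed_def
  proof (intro conjI ballI impI)
    show "Z \<noteq> {}" using Z0 by blast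
    show "\<exists>k\<in>Z. i \<le> k \<and> j \<le> k" if "i \<in> Z" "j \<in> Z" for i j
      using Z_sup[OF that] by (intro bexI[of _ "sup i j"]) auto
  qed (auto intro: order_trans)
  have "((\<lambda>z. norm (u - z)) \<longlongrightarrow> 0) (net_filter Z (\<le>))"
  proof (rule order_continuous_norm_net[OF oc dir])
    show "u - j \<le> u - i" if "i \<le> j" for i j :: 'a using that by simp
    show "0 \<le> u - i" if "i \<in> Z" for i using that unfolding Z_def by simp
    show "l \<le> 0" if l: "\<And>z. z \<in> Z \<Longrightarrow> l \<le> u - z" for l
    proof (rule ccontr)
      assume "\<not> l \<le> 0"
      then have "0 < pprt l"
        using le_zero_iff_zero_pprt[of l] zero_le_pprt[of l] by (simp add: less_le)
      then obtain a where a: "atom a" "a \<le> pprt l"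
        using disc unfolding discrete_lattice_def by blast
      have a_pos: "0 < a" using a(1) unfolding atom_def by blast
      have step: "z + a \<in> Z" if z: "z \<in> Z" for z
      proof -
        obtain F c where F: "finite F" "\<forall>a\<in>F. atom a" "0 \<le> c" "z \<le> c *\<^sub>R (\<Sum>a\<in>F. a)"
          using z unfolding Z_def by blast
        have "pprt l \<le> u - z"
          using l[OF z] z unfolding Z_def pprt_def by simp
        then have "z + a \<le> u" using a(2) by (metis add.commute le_diff_eq order_trans)
        moreover have "z + a \<le> c *\<^sub>R (\<Sum>a\<in>insert a F. a) + 1 *\<^sub>R (\<Sum>a\<in>insert a F. a)"
        proof (rule add_mono)
          show "z \<le> c *\<^sub>R (\<Sum>a\<in>insert a F. a)"
            using F a(1) by (intro order_trans[OF F(4)] sum_mono_atoms) auto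
          show "a \<le> 1 *\<^sub>R (\<Sum>a\<in>insert a F. a)"
            using sum_mono_atoms[of "insert a F" "{a}" 1 1] F a(1) by auto
        qed
        then have "z + a \<le> (c + 1) *\<^sub>R (\<Sum>a\<in>insert a F. a)"
          by (simp only: scaleR_add_left)
        moreover have "finite (insert a F)" "\<forall>b\<in>insert a F. atom b" "0 \<le> c + 1"
          using F a(1) by auto
        ultimately show ?thesis
          using z a_pos unfolding Z_def by (blast intro: add_nonneg_nonneg less_imp_le)
      qed
      have n: "real n *\<^sub>R a \<in> Z" for n
      proof (induction n)
        case 0
        show ?case using Z0 by simp
      next
        case (Suc n)
        then show ?case using step[OF Suc] by (simp add: scaleR_add_left add.commute)
      qed
      have "real n * norm a \<le> norm u" for n
      proof -
        have "norm (real n *\<^sub>R a) \<le> norm u"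
          using n[of n] unfolding Z_def by (intro norm_mono_nonneg) auto
        then show ?thesis by simp
      qed
      moreover have "0 < norm a" using a_pos by auto
      ultimately show False using reals_Archimedean3[of "norm a"] by (meson not_le)
    qed
  qed
  then have "eventually (\<lambda>z. norm (u - z) < e) (net_filter Z (\<le>))"
    using e by (intro order_tendstoD)
  then obtain z where "z \<in> Z" "norm (u - z) < e"
    unfolding eventually_net_filter[OF dir] by blast
  then show ?thesis unfolding Z_def by blast
qed

theorem weak_imp_un_tendsto:
  fixes f :: "'i \<Rightarrow> 'a :: banach_lattice"
  assumes disc: "discrete_lattice TYPE('a)" and oc: "order_continuous_norm TYPE('a)"
    and f: "limitin weak_topology f y F"
  shows "un_tendsto f y F"
  unfolding un_tendsto_def
proof (intro allI impI tendstoI)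
  fix u :: 'a and e :: real assume u: "0 \<le> u" and e: "0 < e"
  then have e2: "0 < e / 2" by simp
  obtain G c z where G_fin: "finite G" and G_atom: "\<forall>a\<in>G. atom a" and c: "0 \<le> c"
    and z: "0 \<le> z" "z \<le> u" "z \<le> c *\<^sub>R (\<Sum>a\<in>G. a)" "norm (u - z) < e / 2"
    using discrete_approx[OF disc oc u e2] by blast
  note G = G_fin bspec[OF G_atom]
  have "\<forall>a\<in>G. \<exists>\<phi> :: 'a \<Rightarrow>\<^sub>L real. \<forall>x t. 0 \<le> t \<longrightarrow> t *\<^sub>R a \<le> \<bar>x\<bar> \<longrightarrow> t \<le> \<bar>\<phi> x\<bar>"
  proof
    fix a assume "a \<in> G"
    then show "\<exists>\<phi> :: 'a \<Rightarrow>\<^sub>L real. \<forall>x t. 0 \<le> t \<longrightarrow> t *\<^sub>R a \<le> \<bar>x\<bar> \<longrightarrow> t \<le> \<bar>\<phi> x\<bar>"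
      by (rule atom_functional[OF G(2)]) blast
  qed
  from bchoice[OF this] obtain \<phi> :: "'a \<Rightarrow> 'a \<Rightarrow>\<^sub>L real" where
    \<phi>: "\<And>a x t. a \<in> G \<Longrightarrow> 0 \<le> t \<Longrightarrow> t *\<^sub>R a \<le> \<bar>x\<bar> \<Longrightarrow> t \<le> \<bar>\<phi> a x\<bar>"
    by blast
  have "((\<lambda>i. \<Sum>a\<in>G. \<bar>\<phi> a (f i) - \<phi> a y\<bar> * norm a) \<longlongrightarrow> (\<Sum>a\<in>G. \<bar>\<phi> a y - \<phi> a y\<bar> * norm a)) F"
    using f unfolding limitin_weak_topology_iff
    by (intro tendsto_sum tendsto_mult tendsto_rabs tendsto_diff tendsto_const) auto
  then have "eventually (\<lambda>i. (\<Sum>a\<in>G. \<bar>\<phi> a (f i) - \<phi> a y\<bar> * norm a) < e / 2) F"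
    using e by (intro order_tendstoD) auto
  then show "eventually (\<lambda>i. dist (norm (inf \<bar>f i - y\<bar> u)) 0 < e) F"
  proof eventually_elim
    case (elim i)
    let ?x = "f i - y"
    have a_pos: "0 \<le> a" if "a \<in> G" for a using G(2)[OF that] unfolding atom_def by auto
    \<comment> \<open>Below \<open>c a\<close> there are only multiples of \<open>a\<close>, so the
      meet is \<open>s a\<close>, and the coordinate functional of \<open>a\<close> bounds
      \<open>s\<close>.\<close>
    have coord: "norm (inf \<bar>?x\<bar> (c *\<^sub>R a)) \<le> \<bar>\<phi> a ?x\<bar> * norm a" if a: "a \<in> G" for a
    proof -
      have ca: "0 \<le> c *\<^sub>R a" using c a_pos[OF a] by (rule scaleR_nonneg_nonneg)
      have "0 \<le> inf \<bar>?x\<bar> (c *\<^sub>R a)" using ca by (intro inf_greatest abs_ge_zero)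
      then obtain s where s: "0 \<le> s" "inf \<bar>?x\<bar> (c *\<^sub>R a) = s *\<^sub>R a"
        using atom_interval[OF G(2)[OF a] _ inf_le2] by blast
      have "s *\<^sub>R a \<le> \<bar>?x\<bar>" unfolding s(2)[symmetric] by (rule inf_le1)
      then have "s \<le> \<bar>\<phi> a ?x\<bar>" by (rule \<phi>[OF a s(1)])
      then show ?thesis using s by (simp add: mult_right_mono)
    qed
    have "inf \<bar>?x\<bar> z \<le> inf \<bar>?x\<bar> (\<Sum>a\<in>G. c *\<^sub>R a)"
      using z(3) by (intro inf_mono) (simp_all add: scaleR_sum_right)
    also have "\<dots> \<le> (\<Sum>a\<in>G. inf \<bar>?x\<bar> (c *\<^sub>R a))"
      using G(1) c a_pos by (intro inf_sum_le) (auto intro: scaleR_nonneg_nonneg)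
    finally have "norm (inf \<bar>?x\<bar> z) \<le> norm (\<Sum>a\<in>G. inf \<bar>?x\<bar> (c *\<^sub>R a))"
      using z by (intro norm_mono_nonneg) auto
    also have "\<dots> \<le> (\<Sum>a\<in>G. \<bar>\<phi> a ?x\<bar> * norm a)"
      by (intro sum_norm_le coord)
    finally have le: "norm (inf \<bar>?x\<bar> z) < e / 2"
      using elim by (simp add: blinfun.diff_right)
    have "inf \<bar>?x\<bar> (z + (u - z)) \<le> inf \<bar>?x\<bar> z + inf \<bar>?x\<bar> (u - z)"
      using z by (intro inf_add_le) auto
    also have "\<dots> \<le> inf \<bar>?x\<bar> z + (u - z)" by (intro add_left_mono) simp
    finally have "norm (inf \<bar>?x\<bar> u) \<le> norm (inf \<bar>?x\<bar> z + (u - z))"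
      using u by (intro norm_mono_nonneg) auto
    also have "\<dots> < e" using norm_triangle_ineq[of "inf \<bar>?x\<bar> z" "u - z"] le z(4) by simp
    finally show ?case by simp
  qed
qed


section \<open>Compactness of operators\<close>

lemma net_filter_ne_bot:
  assumes "directed I le"
  shows "net_filter I le \<noteq> bot"
proof
  assume "net_filter I le = bot"
  then have "eventually (\<lambda>_. False) (net_filter I le)" by simp
  then obtain i where "i \<in> I" "\<not> le i i"
    unfolding eventually_net_filter[OF assms] by blast
  moreover have "\<forall>i\<in>I. le i i" using assms unfolding directed_def by simp
  ultimately show False by blast
qed

lemma un_tendsto_imp_uaw:
  assumes "un_tendsto f y F"
  shows "uaw_tendsto f y F"
  unfolding uaw_tendsto_def limitin_weak_topology_iff
proof (intro allI impI)
  fix u :: 'b and \<phi> :: "'b \<Rightarrow>\<^sub>L real" assume "0 \<le> u"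
  then have "((\<lambda>i. inf \<bar>f i - y\<bar> u) \<longlongrightarrow> 0) F"
    using assms unfolding un_tendsto_def by (auto intro!: tendsto_norm_zero_cancel[where f = "\<lambda>i. inf \<bar>f i - y\<bar> u"])
  then show "((\<lambda>i. \<phi> (inf \<bar>f i - y\<bar> u)) \<longlongrightarrow> \<phi> 0) F"
    by (intro blinfun.tendsto tendsto_const)
qed

lemma limitin_weak_scaleR:
  assumes "limitin weak_topology f y F"
  shows "limitin weak_topology (\<lambda>i. c *\<^sub>R f i) (c *\<^sub>R y) F"
  using assms unfolding limitin_weak_topology_iff
  by (auto simp: blinfun.scaleR_right intro: tendsto_mult)

lemma weakly_compact_op_seq:
  fixes T :: "'x :: real_normed_vector \<Rightarrow>\<^sub>L 'e :: real_normed_vector" and x :: "nat \<Rightarrow> 'x"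
  assumes T: "weakly_compact_op T" and x: "bounded (range x)"
  obtains r y where "strict_mono r" "limitin weak_topology (\<lambda>n. T (x (r n))) y sequentially"
proof -
  obtain R where R: "0 < R" "\<And>n. norm (x n) \<le> R"
    using x unfolding bounded_pos by auto
  define a where "a n = T (x n /\<^sub>R R)" for n
  have "a n \<in> weak_topology closure_of (T ` cball 0 1)" for n
    using R unfolding a_def
    by (intro subsetD[OF closure_of_subset]) (auto simp: field_simps)
  then obtain r y where r: "strict_mono r" "limitin weak_topology (\<lambda>n. a (r n)) y sequentially"
    using weakly_compact_imp_seq[OF T[unfolded weakly_compact_op_def], of a] by blast
  have "T (x n) = R *\<^sub>R a n" for n
    using R unfolding a_def by (simp add: blinfun.scaleR_right)
  then show thesis
    using that[OF r(1)] limitin_weak_scaleR[OF r(2), of R] by simp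
qed

text \<open>The net is rescaled into the unit ball, and a weak cluster point is turned into a subnet
  limit by \<open>subnet_if_clusters\<close>. That lemma also produces the index type prescribed in
  \<open>un_compact_op\<close>.\<close>

lemma weakly_compact_op_net:
  fixes T :: "'x :: real_normed_vector \<Rightarrow>\<^sub>L 'e :: real_normed_vector" and x :: "'i \<Rightarrow> 'x"
  assumes T: "weakly_compact_op T" and I: "directed I le" and x: "bounded (x ` I)"
  obtains J :: "('i \<times> 'e set) set" and le' h y where "directed J le'" "subnet_map J le' I le h"
    "limitin weak_topology (\<lambda>j. T (x (h j))) y (net_filter J le')"
proof -
  obtain R where R: "0 < R" "\<And>i. i \<in> I \<Longrightarrow> norm (x i) \<le> R"
    using x unfolding bounded_pos by auto
  define a where "a i = T (x i /\<^sub>R R)" for i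
  let ?K = "weak_topology closure_of (T ` cball 0 1)"
  have aK: "a i \<in> ?K" if "i \<in> I" for i
    using R that unfolding a_def
    by (intro subsetD[OF closure_of_subset]) (auto simp: field_simps)
  obtain i0 where "i0 \<in> I" using I unfolding directed_def by blast
  then have "eventually (\<lambda>i. a i \<in> ?K) (net_filter I le)"
    unfolding eventually_net_filter[OF I] using aK by blast
  then obtain y where y: "\<And>\<Phi> (e :: real). finite \<Phi> \<Longrightarrow> 0 < e \<Longrightarrow>
      frequently (\<lambda>i. \<forall>\<phi>\<in>\<Phi>. \<bar>blinfun_apply \<phi> (a i) - blinfun_apply \<phi> y\<bar> < e) (net_filter I le)"
    by (rule weak_cluster_point[OF T[unfolded weakly_compact_op_def] _ net_filter_ne_bot[OF I]]) blast
  \<comment> \<open>Radius 1 suffices because all functionals are allowed: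
    \<open>U (\<phi> /\<^sub>R e)\<close> is the neighbourhood of radius \<open>e\<close> for
    \<open>\<phi>\<close>.\<close>
  define U where "U \<phi> = {w. \<bar>blinfun_apply \<phi> w - blinfun_apply \<phi> y\<bar> < 1}" for \<phi> :: "'e \<Rightarrow>\<^sub>L real"
  have "clusters (range U) I le a"
    unfolding clusters_def
  proof (intro allI impI ballI)
    fix \<F> i assume \<F>: "finite \<F> \<and> \<F> \<subseteq> range U" and i: "i \<in> I"
    obtain \<Phi> where \<Phi>: "finite \<Phi>" "\<F> = U ` \<Phi>"
      using \<F> finite_subset_image[of \<F> U UNIV] by blast
    have "\<not> eventually (\<lambda>k. \<not> (\<forall>\<phi>\<in>\<Phi>. \<bar>blinfun_apply \<phi> (a k) - blinfun_apply \<phi> y\<bar> < 1)) (net_filter I le)"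
      using y[OF \<Phi>(1), of 1] unfolding frequently_def by simp
    then obtain k where "k \<in> I" "le i k" "\<forall>\<phi>\<in>\<Phi>. \<bar>blinfun_apply \<phi> (a k) - blinfun_apply \<phi> y\<bar> < 1"
      unfolding eventually_net_filter[OF I] using i by blast
    then show "\<exists>k\<in>I. le i k \<and> a k \<in> \<Inter>\<F>"
      unfolding \<Phi>(2) U_def by blast
  qed
  then obtain J :: "('i \<times> 'e set) set" and le' h where J: "directed J le'" "subnet_map J le' I le h"
    and ev: "\<And>V. V \<in> range U \<Longrightarrow> eventually (\<lambda>j. a (h j) \<in> V) (net_filter J le')"
    by (rule subnet_if_clusters[OF I]) (rule that)
  have "limitin weak_topology (\<lambda>j. a (h j)) y (net_filter J le')"
    unfolding limitin_weak_topology_iff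
  proof (intro allI tendstoI)
    fix \<phi> :: "'e \<Rightarrow>\<^sub>L real" and e :: real assume e: "0 < e"
    have "eventually (\<lambda>j. a (h j) \<in> U (\<phi> /\<^sub>R e)) (net_filter J le')"
      by (intro ev) blast
    then show "eventually (\<lambda>j. dist (\<phi> (a (h j))) (\<phi> y) < e) (net_filter J le')"
    proof eventually_elim
      case (elim j)
      then have "inverse e * \<bar>\<phi> (a (h j)) - \<phi> y\<bar> < 1"
        using e unfolding U_def
        by (simp add: blinfun.scaleR_left abs_mult flip: right_diff_distrib)
      then show ?case using e by (simp add: dist_real_def field_simps)
    qed
  qed
  then have "limitin weak_topology (\<lambda>j. R *\<^sub>R a (h j)) (R *\<^sub>R y) (net_filter J le')"
    by (rule limitin_weak_scaleR)
  moreover have "R *\<^sub>R a i = T (x i)" for i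
    using R unfolding a_def by (simp add: blinfun.scaleR_right)
  ultimately show thesis using that[OF J] by simp
qed

section \<open>The implications between the classes of operators\<close>

lemma bounded_image_cball: "bounded (blinfun_apply T ` cball 0 1)"
  by (rule bounded_linear_image[OF bounded_cball blinfun.bounded_linear_right])

lemma norm_blinfun_le: "norm x \<le> 1 \<Longrightarrow> norm (blinfun_apply T x) \<le> norm T"
  using norm_blinfun[of T x] mult_left_mono[of "norm x" 1 "norm T"] by simp

lemma seq_uaw_imp_weakly_compact:
  fixes T :: "'x :: real_normed_vector \<Rightarrow>\<^sub>L 'e :: banach_lattice"
  assumes oc: "order_continuous_norm TYPE('e \<Rightarrow>\<^sub>L real)" and T: "seq_uaw_compact_op T"
  shows "weakly_compact_op T"
  unfolding weakly_compact_op_def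
proof (intro compactin_weak_closure closure_eval_at_if_seq bounded_image_cball)
  fix a assume "\<And>n :: nat. a n \<in> T ` cball 0 1"
  then have "\<forall>n. \<exists>x. norm x \<le> 1 \<and> a n = T x" by fastforce
  then obtain x where x: "\<And>n. norm (x n) \<le> 1" "\<And>n. a n = T (x n)" by metis
  then have "bounded (range x)" unfolding bounded_iff by blast
  then obtain r y where r: "strict_mono r" "uaw_tendsto (\<lambda>n. T (x (r n))) y sequentially"
    using T unfolding seq_uaw_compact_op_def by blast
  have bd: "norm (T (x n)) \<le> norm T" for n
    by (rule norm_blinfun_le[OF x(1)])
  have "limitin weak_topology (\<lambda>n. T (x (r n))) y sequentially"
    by (rule uaw_tendsto_imp_weak[OF oc r(2) bd])
  then show "\<exists>r y. strict_mono (r :: nat \<Rightarrow> nat) \<and> limitin weak_topology (\<lambda>n. a (r n)) y sequentially"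
    using r(1) x(2) by auto
qed (rule bounded_image_cball)

lemma uaw_imp_weakly_compact:
  fixes T :: "'x :: real_normed_vector \<Rightarrow>\<^sub>L 'e :: banach_lattice"
  assumes oc: "order_continuous_norm TYPE('e \<Rightarrow>\<^sub>L real)" and T: "uaw_compact_op T"
  shows "weakly_compact_op T"
  unfolding weakly_compact_op_def
proof (intro compactin_weak_closure bounded_image_cball)
  fix \<Psi> assume \<Psi>: "\<Psi> \<in> closure (eval_at ` T ` cball 0 1)"
  \<comment> \<open>An index records finitely many functionals and a precision; the chosen
    \<open>x p\<close> matches \<open>\<Psi>\<close> on them to that precision. The images therefore
    converge to \<open>\<Psi>\<close> at every functional, and so does any subnet, whose weak limit
    must represent \<open>\<Psi>\<close>. As this index type differs from the one in
    \<open>uaw_compact_op\<close>, the subnet comes from \<open>uaw_compact_op_net\<close>.\<close>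
  define I where "I = {p :: ('e \<Rightarrow>\<^sub>L real) set \<times> nat. finite (fst p)}"
  define le where "le = (\<lambda>p q :: ('e \<Rightarrow>\<^sub>L real) set \<times> nat. fst p \<subseteq> fst q \<and> snd p \<le> snd q)"
  have I: "directed I le"
    unfolding directed_def
  proof (intro conjI ballI impI)
    show "I \<noteq> {}" unfolding I_def by (auto intro!: exI[of _ "{}"])
    fix p q assume "p \<in> I" "q \<in> I"
    then show "\<exists>k\<in>I. le p k \<and> le q k"
      unfolding I_def le_def by (intro bexI[of _ "(fst p \<union> fst q, max (snd p) (snd q))"]) auto
  qed (auto simp: le_def)
  have "\<exists>x. norm x \<le> 1 \<and> (\<forall>\<phi>\<in>fst p. \<bar>blinfun_apply \<phi> (T x) - \<Psi> \<phi>\<bar> < 1 / real (Suc (snd p)))"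
    if "p \<in> I" for p
    using closure_eval_at_approx[OF \<Psi>, of "fst p" "1 / real (Suc (snd p))"] that
    unfolding I_def by auto
  then have "\<forall>p. \<exists>x. p \<in> I \<longrightarrow> norm x \<le> 1 \<and>
      (\<forall>\<phi>\<in>fst p. \<bar>blinfun_apply \<phi> (T x) - \<Psi> \<phi>\<bar> < 1 / real (Suc (snd p)))"
    by blast
  then obtain x where x: "\<And>p. p \<in> I \<Longrightarrow> norm (x p) \<le> 1"
    "\<And>p \<phi>. p \<in> I \<Longrightarrow> \<phi> \<in> fst p \<Longrightarrow> \<bar>blinfun_apply \<phi> (T (x p)) - \<Psi> \<phi>\<bar> < 1 / real (Suc (snd p))"
    by metis
  \<comment> \<open>The value 0 outside \<open>I\<close> provides a norm bound at every index of the
    type, as \<open>uaw_tendsto_imp_weak\<close> expects.\<close>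
  define z where "z p = (if p \<in> I then x p else 0)" for p
  have "bounded (z ` I)"
    unfolding bounded_iff z_def using x(1) by (intro exI[of _ 1]) simp
  then obtain J :: "((('e \<Rightarrow>\<^sub>L real) set \<times> nat) \<times> 'e set) set" and le' h y where
    J: "directed J le'" and h: "subnet_map J le' I le h"
    and lim: "uaw_tendsto (\<lambda>j. T (z (h j))) y (net_filter J le')"
    using uaw_compact_op_net[OF T I] by blast
  have bd: "norm (T (z p)) \<le> norm T" for p
    using x(1) unfolding z_def by (intro norm_blinfun_le) simp
  have lim: "limitin weak_topology (\<lambda>j. T (z (h j))) y (net_filter J le')"
    by (rule uaw_tendsto_imp_weak[OF oc lim bd])
  have "\<Psi> \<phi> = blinfun_apply \<phi> y" for \<phi>
  proof (rule tendsto_unique[OF net_filter_ne_bot[OF J]])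
    show "((\<lambda>j. blinfun_apply \<phi> (T (z (h j)))) \<longlongrightarrow> blinfun_apply \<phi> y) (net_filter J le')"
      using lim unfolding limitin_weak_topology_iff by blast
    show "((\<lambda>j. blinfun_apply \<phi> (T (z (h j)))) \<longlongrightarrow> \<Psi> \<phi>) (net_filter J le')"
    proof (rule tendstoI)
      fix e :: real assume "0 < e"
      then obtain n where n: "1 / real (Suc n) < e"
        using reals_Archimedean[of e] by (auto simp: inverse_eq_divide)
      have "({\<phi>}, n) \<in> I" unfolding I_def by simp
      then obtain j0 where j0: "j0 \<in> J" "\<And>j. j \<in> J \<Longrightarrow> le' j0 j \<Longrightarrow> le ({\<phi>}, n) (h j)"
        using h unfolding subnet_map_def by blast
      have "dist (blinfun_apply \<phi> (T (z (h j)))) (\<Psi> \<phi>) < e" if j: "j \<in> J" "le' j0 j" for j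
      proof -
        have hj: "h j \<in> I" "\<phi> \<in> fst (h j)" "n \<le> snd (h j)"
          using h j j0(2)[OF j] unfolding subnet_map_def le_def by auto
        then have "\<bar>blinfun_apply \<phi> (T (z (h j))) - \<Psi> \<phi>\<bar> < 1 / real (Suc (snd (h j)))"
          using x(2) unfolding z_def by simp
        also have "\<dots> \<le> 1 / real (Suc n)" using hj(3) by (intro divide_left_mono) auto
        finally show ?thesis using n by (simp add: dist_real_def)
      qed
      then show "eventually (\<lambda>j. dist (blinfun_apply \<phi> (T (z (h j)))) (\<Psi> \<phi>) < e) (net_filter J le')"
        unfolding eventually_net_filter[OF J] using j0(1) by blast
    qed
  qed
  then show "\<exists>x. \<Psi> = eval_at x" by blast
qed

lemma weakly_compact_imp_seq_uaw:
  fixes T :: "'x :: real_normed_vector \<Rightarrow>\<^sub>L 'e :: banach_lattice"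
  assumes lat: "lattice_ops_seq_weakly_continuous TYPE('e)" and T: "weakly_compact_op T"
  shows "seq_uaw_compact_op T"
  unfolding seq_uaw_compact_op_def
proof (intro allI impI)
  fix x :: "nat \<Rightarrow> 'x" assume "bounded (range x)"
  then obtain r y where r: "strict_mono r"
    and lim: "limitin weak_topology (\<lambda>n. T (x (r n))) y sequentially"
    using weakly_compact_op_seq[OF T] by blast
  define z where "z n = T (x (r n)) - y" for n
  have "limitin weak_topology z 0 sequentially"
    using lim unfolding limitin_weak_topology_iff z_def
    by (auto simp: blinfun.diff_right blinfun.zero_right intro: LIM_zero)
  then have abs: "limitin weak_topology (\<lambda>n. \<bar>z n\<bar>) 0 sequentially"
    using lat unfolding lattice_ops_seq_weakly_continuous_def by blast
  have "(\<lambda>n. \<phi> (inf \<bar>z n\<bar> u)) \<longlonglongrightarrow> 0" if u: "0 \<le> u" for u and \<phi> :: "'e \<Rightarrow>\<^sub>L real"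
  proof -
    \<comment> \<open>The meet with \<open>u\<close> need not be controlled by \<open>\<phi>\<close>
      itself, but a positive dominating \<open>g\<close> is monotone, so
      \<open>g \<bar>z n\<bar>\<close> bounds it.\<close>
    obtain g :: "'e \<Rightarrow>\<^sub>L real" where g: "0 \<le> g" "\<And>x. \<bar>\<phi> x\<bar> \<le> g \<bar>x\<bar>"
      by (rule abs_functional[of \<phi>]) (rule that)
    have le: "\<bar>\<phi> (inf \<bar>z n\<bar> u)\<bar> \<le> g \<bar>z n\<bar>" for n
      using g(2)[of "inf \<bar>z n\<bar> u"] u positive_blinfun_mono[OF g(1), of "inf \<bar>z n\<bar> u" "\<bar>z n\<bar>"]
      by simp
    have lim0: "(\<lambda>n. g \<bar>z n\<bar>) \<longlonglongrightarrow> 0"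
      using abs unfolding limitin_weak_topology_iff by simp
    show ?thesis
      by (rule Lim_null_comparison[OF _ lim0]) (simp add: le)
  qed
  then have "uaw_tendsto (\<lambda>n. T (x (r n))) y sequentially"
    unfolding uaw_tendsto_def limitin_weak_topology_iff z_def by (simp add: blinfun.zero_right)
  then show "\<exists>r y. strict_mono r \<and> uaw_tendsto (\<lambda>n. T (x (r n))) y sequentially"
    using r by blast
qed

lemma weakly_compact_imp_un:
  fixes T :: "'x :: real_normed_vector \<Rightarrow>\<^sub>L 'e :: banach_lattice"
  assumes disc: "discrete_lattice TYPE('e)" and oc: "order_continuous_norm TYPE('e)"
    and T: "weakly_compact_op T"
  shows "un_compact_op T" "seq_un_compact_op T"
proof -
  note un = weak_imp_un_tendsto[OF disc oc]
  show "un_compact_op T"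
    unfolding un_compact_op_def
  proof (intro allI impI, elim conjE)
    fix I :: "('x \<times> 'x set) set" and le and x :: "'x \<times> 'x set \<Rightarrow> 'x"
    assume "directed I le" "bounded (x ` I)"
    then obtain J :: "(('x \<times> 'x set) \<times> 'e set) set" and le' h y where
      "directed J le'" "subnet_map J le' I le h"
      "limitin weak_topology (\<lambda>j. T (x (h j))) y (net_filter J le')"
      by (rule weakly_compact_op_net[OF T])
    then show "\<exists>(J :: (('x \<times> 'x set) \<times> 'e set) set) le' h y.
        directed J le' \<and> subnet_map J le' I le h \<and>
        un_tendsto (\<lambda>j. T (x (h j))) y (net_filter J le')"
      using un by blast
  qed
  show "seq_un_compact_op T"
    unfolding seq_un_compact_op_def using weakly_compact_op_seq[OF T] un by metis
qed

lemma un_compact_op_imp_uaw: "un_compact_op T \<Longrightarrow> uaw_compact_op T"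
  unfolding un_compact_op_def uaw_compact_op_def using un_tendsto_imp_uaw by metis

lemma seq_un_compact_op_imp_uaw: "seq_un_compact_op T \<Longrightarrow> seq_uaw_compact_op T"
  unfolding seq_un_compact_op_def seq_uaw_compact_op_def using un_tendsto_imp_uaw by metis

theorem proposition2p10:
  fixes T :: "'x :: banach \<Rightarrow>\<^sub>L 'e :: banach_lattice"
  shows
    "(order_continuous_norm TYPE('e \<Rightarrow>\<^sub>L real) \<and> (uaw_compact_op T \<or> seq_uaw_compact_op T) \<longrightarrow>
        weakly_compact_op T) \<and>
     (lattice_ops_seq_weakly_continuous TYPE('e) \<and> weakly_compact_op T \<longrightarrow>
        seq_uaw_compact_op T) \<and>
     (lattice_ops_seq_weakly_continuous TYPE('e) \<and> order_continuous_norm TYPE('e \<Rightarrow>\<^sub>L real) \<longrightarrow>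
        (weakly_compact_op T \<longleftrightarrow> seq_uaw_compact_op T)) \<and>
     (discrete_lattice TYPE('e) \<and> order_continuous_norm TYPE('e) \<and>
        order_continuous_norm TYPE('e \<Rightarrow>\<^sub>L real) \<longrightarrow>
        (weakly_compact_op T \<longleftrightarrow> uaw_compact_op T) \<and>
        (weakly_compact_op T \<longleftrightarrow> seq_uaw_compact_op T) \<and>
        (weakly_compact_op T \<longleftrightarrow> un_compact_op T) \<and>
        (weakly_compact_op T \<longleftrightarrow> seq_un_compact_op T))"
  \<comment> \<open>Part (4) consists of two circles, one for nets and one for sequences: weak
    compactness gives un-compactness, this gives uaw-compactness, and part (1) leads back.\<close>
  using seq_uaw_imp_weakly_compact[of T] uaw_imp_weakly_compact[of T]
    weakly_compact_imp_seq_uaw[of T] weakly_compact_imp_un[of T]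
    un_compact_op_imp_uaw[of T] seq_un_compact_op_imp_uaw[of T]
  by blast

end
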